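(* Let $C$ be the covariance operator of a random function $X$ with values in $L^2$ such that $E\|X\|^2<\infty$. For each $N$ let $\widehat C$ (depending on $N$) be an estimator of $C$ which is a.s. symmetric, nonnegative-definite and Hilbert–Schmidt. Assume that for some random operator $Z\in\mathcal{S}$ and some $r_N\to\infty$, $$Z_N := r_N(\widehat C - C)\xrightarrow{d} Z \quad\text{in } \mathcal{S}.$$ Let $\lambda_j, v_j$ and $\hat\lambda_j,\hat v_j$ be the eigenvalues (in decreasing order) and orthonormal eigenfunctions of $C$ and $\widehat C$, respectively, and suppose that $\lambda_1>\lambda_2>\cdots>\lambda_p>\lambda_{p+1}$. Set $$T_j = \sum_{k\ne j}(\lambda_j-\lambda_k)^{-1}\langle Z, v_j\otimes v_k\rangle_{\mathcal{S}}\, v_k, \quad 1\le j\le p.$$ Then, as $N\to\infty$, $$r_N\{\hat v_j - v_j,\ 1\le j\le p\}\xrightarrow{d}\{T_j,\ 1\le j\le p\}\quad\text{in }(L^2)^p,$$ and $$r_N\{\hat\lambda_j-\lambda_j,\ 1\le j\le p\}\xrightarrow{d}\{\langle Z(v_j),v_j\rangle,\ 1\le j\le p\}\quad\text{in }\mathbb{R}^p.$$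
   Context: $L^2=L^2(\mathcal{T})$ is the separable Hilbert space of square integrable real functions on a compact subset $\mathcal{T}$ of a Euclidean space. $\mathcal{S}$ is the Hilbert space of Hilbert–Schmidt operators on $L^2$ with $\langle \Psi_1,\Psi_2\rangle_{\mathcal{S}}=\sum_j\langle\Psi_1(e_j),\Psi_2(e_j)\rangle$ for any orthonormal basis $\{e_j\}$. For $y,z\in L^2$, $(y\otimes z)(x)=\langle y,x\rangle z$. The eigenelements satisfy $C(v_j)=\lambda_j v_j$, $\widehat C(\hat v_j)=\hat\lambda_j\hat v_j$, $j\ge1$; the system $\{v_j, j\ge 1\}$ is an orthonormal basis of $L^2$ (so that $\{v_j\otimes v_k\}$ is an orthonormal basis of $\mathcal{S}$). Eigenfunctions are determined only up to sign; the convention is that the sign of $\hat v_j$ is chosen so that $\operatorname{sign}\langle\hat v_j,v_j\rangle=1$. *)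

theory Defs
  imports "HOL-Probability.Probability"
begin

section \<open>The space of square integrable functions\<close>

definition square_integrable_on :: "('e::euclidean_space \<Rightarrow> real) \<Rightarrow> 'e set \<Rightarrow> bool" where
  "square_integrable_on f T \<longleftrightarrow>
     f \<in> borel_measurable (lebesgue_on T) \<and> integrable (lebesgue_on T) (\<lambda>t. (f t)\<^sup>2)"

text \<open>
  A type cannot depend on the set \<open>T\<close>, so \<open>L\<^sup>2(T)\<close> is a type \<open>'h\<close> together with a choice of
  representatives \<open>J h\<close>: up to equality almost everywhere, \<open>J\<close> is a linear isometry of \<open>'h\<close> onto
  the square integrable functions on \<open>T\<close>.
\<close>

definition is_L2 :: "'e::euclidean_space set \<Rightarrow> ('h::real_inner \<Rightarrow> 'e \<Rightarrow> real) \<Rightarrow> bool" where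
  "is_L2 T J \<longleftrightarrow>
     (\<forall>x. square_integrable_on (J x) T) \<and>
     (\<forall>f. square_integrable_on f T \<longrightarrow> (\<exists>x. AE t in lebesgue_on T. J x t = f t)) \<and>
     (\<forall>x y. AE t in lebesgue_on T. J (x + y) t = J x t + J y t) \<and>
     (\<forall>c x. AE t in lebesgue_on T. J (c *\<^sub>R x) t = c * J x t) \<and>
     (\<forall>x y. inner x y = (\<integral>t. J x t * J y t \<partial>lebesgue_on T))"


section \<open>Orthonormal bases\<close>

definition orthonormal :: "'h::real_inner set \<Rightarrow> bool" where
  "orthonormal B \<longleftrightarrow> pairwise orthogonal B \<and> (\<forall>e\<in>B. norm e = 1)"

definition orthonormal_basis :: "'h::real_inner set \<Rightarrow> bool" where
  "orthonormal_basis B \<longleftrightarrow> orthonormal B \<and> closure (span B) = UNIV"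

lemma orthonormal_inner:
  "orthonormal B \<Longrightarrow> x \<in> B \<Longrightarrow> y \<in> B \<Longrightarrow> inner x y = (if x = y then 1 else 0)"
  unfolding orthonormal_def pairwise_def orthogonal_def
  by (auto simp: norm_eq_sqrt_inner)

lemma orthonormal_subset: "orthonormal B \<Longrightarrow> F \<subseteq> B \<Longrightarrow> orthonormal F"
  unfolding orthonormal_def by (blast intro: pairwise_mono)

lemma norm_sum_orthonormal:
  assumes "orthonormal F" "finite F"
  shows "(norm (\<Sum>e\<in>F. c e *\<^sub>R e))\<^sup>2 = (\<Sum>e\<in>F. (c e)\<^sup>2)"
proof -
  have "(norm (\<Sum>e\<in>F. c e *\<^sub>R e))\<^sup>2 = (\<Sum>e\<in>F. \<Sum>f\<in>F. c e * (c f * inner e f))"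
    by (simp add: power2_norm_eq_inner inner_sum_left inner_sum_right sum_distrib_left inner_commute mult_ac)
  also have "\<dots> = (\<Sum>e\<in>F. \<Sum>f\<in>F. if e = f then (c e)\<^sup>2 else 0)"
    by (intro sum.cong) (auto simp: orthonormal_inner[OF assms(1)] power2_eq_square)
  finally show ?thesis using assms(2) by simp
qed

primrec gram_schmidt :: "(nat \<Rightarrow> 'h::real_inner) \<Rightarrow> nat \<Rightarrow> 'h set" where
  "gram_schmidt d 0 = {}"
| "gram_schmidt d (Suc n) =
     (let B = gram_schmidt d n; u = d n - (\<Sum>e\<in>B. inner e (d n) *\<^sub>R e)
      in if u = 0 then B else insert (u /\<^sub>R norm u) B)"

lemma gram_schmidt:
  "finite (gram_schmidt d n) \<and> orthonormal (gram_schmidt d n) \<and> d ` {..<n} \<subseteq> span (gram_schmidt d n)"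
proof (induction n)
  case 0
  then show ?case by (simp add: orthonormal_def)
next
  case (Suc n)
  define B where "B = gram_schmidt d n"
  define w where "w = (\<Sum>e\<in>B. inner e (d n) *\<^sub>R e)"
  define u where "u = d n - w"
  have B: "finite B" "orthonormal B" "d ` {..<n} \<subseteq> span B"
    using Suc by (auto simp: B_def)
  have w: "w \<in> span B" unfolding w_def
    by (intro span_sum span_scale span_base)
  have step: "gram_schmidt d (Suc n) = (if u = 0 then B else insert (u /\<^sub>R norm u) B)"
    by (simp add: Let_def B_def u_def w_def)
  show ?case
  proof (cases "u = 0")
    case True
    then have "d n \<in> span B" using w by (simp add: u_def)
    then show ?thesis using True B step by (auto simp: lessThan_Suc)
  next
    case False
    have orth: "inner u e = 0" if "e \<in> B" for e
    proof -
      have "inner w e = (\<Sum>f\<in>B. if f = e then inner e (d n) else 0)"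
        unfolding w_def inner_sum_left
        by (intro sum.cong) (auto simp: orthonormal_inner[OF B(2)] that)
      then show ?thesis using B(1) that
        by (simp add: u_def inner_diff_left inner_commute[of e])
    qed
    let ?B = "insert (u /\<^sub>R norm u) B"
    have "orthonormal ?B"
      unfolding orthonormal_def pairwise_insert
      using B(2) orth False
      by (simp add: orthonormal_def orthogonal_def inner_commute[of _ u])
    moreover have "d n \<in> span ?B"
    proof -
      have "w \<in> span ?B" using w span_mono[of B ?B] by auto
      then have "norm u *\<^sub>R (u /\<^sub>R norm u) + w \<in> span ?B"
        by (intro span_add span_scale[OF span_base]) auto
      then show ?thesis using False by (simp add: u_def)
    qed
    moreover have "d ` {..<n} \<subseteq> span ?B"
      using B(3) span_mono[of B ?B] by auto
    ultimately show ?thesis using False B(1) step by (auto simp: lessThan_Suc)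
  qed
qed

lemma gram_schmidt_mono: "m \<le> n \<Longrightarrow> gram_schmidt d m \<subseteq> gram_schmidt d n"
  by (rule lift_Suc_mono_le[of "gram_schmidt d"]) (auto simp: Let_def)

lemma orthonormal_basis_exists:
  "\<exists>B :: 'h::{real_inner, second_countable_topology} set. orthonormal_basis B"
proof -
  obtain D :: "'h set" where D: "countable D" "\<And>X. open X \<Longrightarrow> X \<noteq> {} \<Longrightarrow> \<exists>d\<in>D. d \<in> X"
    by (rule countable_dense_setE) blast
  have "D \<noteq> {}" using D(2)[of UNIV] by auto
  then have rD: "range (from_nat_into D) = D" using D(1) by simp
  define G where "G = gram_schmidt (from_nat_into D)"
  define B where "B = (\<Union>n. G n)"
  have "orthonormal B"
    unfolding orthonormal_def
  proof (intro conjI pairwiseI ballI)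
    fix x y assume "x \<in> B" "y \<in> B" "x \<noteq> y"
    then obtain m n where "x \<in> G m" "y \<in> G n" by (auto simp: B_def)
    then have "x \<in> G (max m n)" "y \<in> G (max m n)"
      using gram_schmidt_mono[of m "max m n" "from_nat_into D"]
            gram_schmidt_mono[of n "max m n" "from_nat_into D"] by (auto simp: G_def)
    then show "orthogonal x y"
      using gram_schmidt[of "from_nat_into D" "max m n"] \<open>x \<noteq> y\<close>
      by (auto simp: G_def orthonormal_def pairwise_def)
  next
    fix x assume "x \<in> B"
    then obtain n where "x \<in> G n" by (auto simp: B_def)
    then show "norm x = 1"
      using gram_schmidt[of "from_nat_into D" n] by (auto simp: G_def orthonormal_def)
  qed
  moreover have "D \<subseteq> span B"
  proof
    fix x assume "x \<in> D"
    then obtain n where n: "x = from_nat_into D n" using rD by auto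
    have "x \<in> span (G (Suc n))"
      using gram_schmidt[of "from_nat_into D" "Suc n"] unfolding G_def n by auto
    then show "x \<in> span B" using span_mono[of "G (Suc n)" B] by (auto simp: B_def)
  qed
  then have "closure (span B) = UNIV"
    using D(2)[of "- closure (span B)"] closure_subset[of "span B"] by auto
  ultimately show ?thesis unfolding orthonormal_basis_def by blast
qed

lemma has_sum_orthonormal_functional:
  fixes \<phi> :: "'h::real_inner \<Rightarrow> real"
  assumes \<phi>: "bounded_linear \<phi>" and B: "orthonormal_basis B"
  shows "((\<lambda>e. (\<phi> e)\<^sup>2) has_sum (onorm \<phi>)\<^sup>2) B"
proof -
  interpret \<phi>: bounded_linear \<phi> by fact
  have on: "orthonormal B" and dense: "closure (span B) = UNIV"
    using B by (auto simp: orthonormal_basis_def)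
  have bessel: "(\<Sum>e\<in>F. (\<phi> e)\<^sup>2) \<le> (onorm \<phi>)\<^sup>2" if F: "finite F" "F \<subseteq> B" for F
  proof -
    define x where "x = (\<Sum>e\<in>F. \<phi> e *\<^sub>R e)"
    have nx: "(norm x)\<^sup>2 = (\<Sum>e\<in>F. (\<phi> e)\<^sup>2)"
      unfolding x_def by (rule norm_sum_orthonormal[OF orthonormal_subset[OF on F(2)] F(1)])
    have "\<phi> x = (norm x)\<^sup>2"
      unfolding nx by (simp add: x_def \<phi>.sum \<phi>.scaleR power2_eq_square)
    moreover have "\<bar>\<phi> x\<bar> \<le> onorm \<phi> * norm x" using onorm[OF \<phi>, of x] by simp
    ultimately have "norm x * norm x \<le> onorm \<phi> * norm x" by (simp add: power2_eq_square)
    then have "norm x \<le> onorm \<phi>" 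
      by (cases "norm x = 0") (use onorm_pos_le[OF \<phi>] in auto)
    then show ?thesis unfolding nx[symmetric] by (intro power_mono) auto
  qed
  have summable: "(\<lambda>e. (\<phi> e)\<^sup>2) summable_on B"
    by (intro nonneg_bounded_partial_sums_imp_summable_on[where C = "(onorm \<phi>)\<^sup>2"]
        eventually_finite_subsets_at_top_weakI) (auto intro: bessel)
  define S where "S = (\<Sum>\<^sub>\<infinity>e\<in>B. (\<phi> e)\<^sup>2)"
  have S0: "0 \<le> S" unfolding S_def by (intro infsum_nonneg) auto
  have span: "\<bar>\<phi> x\<bar> \<le> sqrt S * norm x" if x: "x \<in> span B" for x
  proof -
    obtain F c where F: "finite F" "F \<subseteq> B" and x: "x = (\<Sum>e\<in>F. c e *\<^sub>R e)"
      using x unfolding span_explicit by auto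
    have "\<phi> x = (\<Sum>e\<in>F. c e * \<phi> e)" by (simp add: x \<phi>.sum \<phi>.scaleR)
    then have "(\<phi> x)\<^sup>2 \<le> (\<Sum>e\<in>F. (c e)\<^sup>2) * (\<Sum>e\<in>F. (\<phi> e)\<^sup>2)"
      by (simp add: Cauchy_Schwarz_ineq_sum)
    also have "\<dots> \<le> (norm x)\<^sup>2 * S"
      unfolding x norm_sum_orthonormal[OF orthonormal_subset[OF on F(2)] F(1)]
      by (intro mult_left_mono) (auto simp: S_def intro!: finite_sum_le_infsum summable F sum_nonneg)
    finally have "(\<phi> x)\<^sup>2 \<le> (sqrt S * norm x)\<^sup>2"
      using S0 by (simp add: power_mult_distrib mult.commute)
    then show ?thesis using S0 by (metis abs_le_square_iff abs_of_nonneg mult_nonneg_nonneg norm_ge_zero real_sqrt_ge_zero)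
  qed
  have "closed {x. \<bar>\<phi> x\<bar> \<le> sqrt S * norm x}"
    by (intro closed_Collect_le continuous_intros \<phi>.continuous_on)
  then have "closure (span B) \<subseteq> {x. \<bar>\<phi> x\<bar> \<le> sqrt S * norm x}"
    by (intro closure_minimal) (use span in auto)
  then have "onorm \<phi> \<le> sqrt S"
    unfolding dense by (intro onorm_bound) (use S0 in auto)
  then have "(onorm \<phi>)\<^sup>2 \<le> (sqrt S)\<^sup>2"
    by (intro power_mono onorm_pos_le \<phi>)
  then have "(onorm \<phi>)\<^sup>2 \<le> S" using S0 by simp
  moreover have "S \<le> (onorm \<phi>)\<^sup>2"
    unfolding S_def by (intro infsum_le_finite_sums summable bessel)
  ultimately show ?thesis using summable unfolding S_def by (metis antisym has_sum_infsum)
qed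

lemma onorm_inner: "onorm (\<lambda>x::'h::real_inner. inner y x) = norm y"
proof (rule antisym)
  show "onorm (\<lambda>x. inner y x) \<le> norm y"
    by (intro onorm_bound) (auto simp: Cauchy_Schwarz_ineq2)
  have "\<bar>inner y y\<bar> \<le> onorm (\<lambda>x. inner y x) * norm y"
    using onorm[OF bounded_linear_inner_right, of y y] by simp
  then show "norm y \<le> onorm (\<lambda>x. inner y x)"
    by (cases "y = 0") (auto simp: dot_square_norm power2_eq_square onorm_pos_le bounded_linear_inner_right)
qed

lemma has_sum_parseval:
  "orthonormal_basis B \<Longrightarrow> ((\<lambda>e. (inner y e)\<^sup>2) has_sum (norm y)\<^sup>2) B"
  using has_sum_orthonormal_functional[OF bounded_linear_inner_right, of B y]
  by (simp add: onorm_inner)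


section \<open>Hilbert--Schmidt operators\<close>

definition some_basis :: "'h::{real_inner, second_countable_topology} set" where
  "some_basis = (SOME B. orthonormal_basis B)"

definition hilbert_schmidt :: "('h::{real_inner, second_countable_topology} \<Rightarrow>\<^sub>L 'h) \<Rightarrow> bool" where
  "hilbert_schmidt A \<longleftrightarrow> (\<lambda>e. (norm (blinfun_apply A e))\<^sup>2) summable_on some_basis"

lemma some_basis: "orthonormal_basis some_basis"
  unfolding some_basis_def by (rule someI_ex) (rule orthonormal_basis_exists)

lemma has_sum_norm_change_basis:
  fixes A :: "'h::real_inner \<Rightarrow>\<^sub>L 'h"
  assumes B: "orthonormal_basis B" and B': "orthonormal_basis B'"
    and A: "((\<lambda>e. (norm (blinfun_apply A e))\<^sup>2) has_sum s) B"
  shows "((\<lambda>e. (norm (blinfun_apply A e))\<^sup>2) has_sum s) B'"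
proof -
  let ?g = "\<lambda>f. (onorm (\<lambda>x. inner f (blinfun_apply A x)))\<^sup>2"
  have bl: "bounded_linear (\<lambda>x. inner f (blinfun_apply A x))" for f
    by (intro bounded_linear_inner_right_comp blinfun.bounded_linear_right)
  have row: "((\<lambda>f. (inner f (blinfun_apply A e))\<^sup>2) has_sum (norm (blinfun_apply A e))\<^sup>2) B" for e
    using has_sum_parseval[OF B, of "blinfun_apply A e"] by (simp add: inner_commute)
  have col: "((\<lambda>e. (inner f (blinfun_apply A e))\<^sup>2) has_sum ?g f) C" if "orthonormal_basis C" for f C
    by (rule has_sum_orthonormal_functional[OF bl that])
  let ?F = "\<lambda>(e, f). (inner f (blinfun_apply A e))\<^sup>2"
  let ?G = "\<lambda>(f, e). (inner f (blinfun_apply A e))\<^sup>2"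
  have "?F summable_on B \<times> B"
    by (rule summable_on_SigmaI[where g = "\<lambda>e. (norm (blinfun_apply A e))\<^sup>2"])
       (use row A in \<open>auto simp: summable_on_def\<close>)
  then have "(?F has_sum s) (B \<times> B)"
    by (intro has_sum_SigmaI[OF _ A]) (use row in auto)
  then have "(?G has_sum s) (B \<times> B)"
    by (subst (asm) has_sum_swap) simp
  then have g: "(?g has_sum s) B"
    by (rule has_sum_SigmaD) (use col[OF B] in simp)
  have "?G summable_on B \<times> B'"
    by (rule summable_on_SigmaI[where g = ?g])
       (use col[OF B'] g in \<open>auto simp: summable_on_def\<close>)
  then have "(?G has_sum s) (B \<times> B')"
    by (intro has_sum_SigmaI[OF _ g]) (use col[OF B'] in auto)
  then have "(?F has_sum s) (B' \<times> B)"
    by (subst (asm) has_sum_swap) simp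
  then show ?thesis
    by (rule has_sum_SigmaD) (use row in simp)
qed

lemma hilbert_schmidt_iff:
  "orthonormal_basis B \<Longrightarrow>
     hilbert_schmidt A \<longleftrightarrow> (\<lambda>e. (norm (blinfun_apply A e))\<^sup>2) summable_on B"
  unfolding hilbert_schmidt_def summable_on_def
  using has_sum_norm_change_basis some_basis by blast

lemma hilbert_schmidt_add:
  assumes "hilbert_schmidt A" "hilbert_schmidt B"
  shows "hilbert_schmidt (A + B)"
  unfolding hilbert_schmidt_def
proof (rule summable_on_comparison_test)
  show "(\<lambda>e. 2 * (norm (blinfun_apply A e))\<^sup>2 + 2 * (norm (blinfun_apply B e))\<^sup>2) summable_on some_basis"
    using assms unfolding hilbert_schmidt_def
    by (intro summable_on_add summable_on_cmult_right)
next
  fix e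
  have "(norm (blinfun_apply (A + B) e))\<^sup>2 \<le> (norm (blinfun_apply A e) + norm (blinfun_apply B e))\<^sup>2"
    by (intro power_mono) (auto simp: blinfun.add_left norm_triangle_ineq)
  also have "\<dots> \<le> 2 * (norm (blinfun_apply A e))\<^sup>2 + 2 * (norm (blinfun_apply B e))\<^sup>2"
    using sum_squares_bound[of "norm (blinfun_apply A e)" "norm (blinfun_apply B e)"]
    by (simp add: power2_sum)
  finally show "(norm (blinfun_apply (A + B) e))\<^sup>2 \<le> \<dots>" .
qed auto

lemma hilbert_schmidt_scaleR: "hilbert_schmidt A \<Longrightarrow> hilbert_schmidt (c *\<^sub>R A)"
  unfolding hilbert_schmidt_def
  by (auto simp: blinfun.scaleR_left power_mult_distrib intro: summable_on_cmult_right)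

lemma hilbert_schmidt_0: "hilbert_schmidt 0"
  by (simp add: hilbert_schmidt_def)

typedef (overloaded) 'h hs =
  "{A :: 'h::{real_inner, second_countable_topology} \<Rightarrow>\<^sub>L 'h. hilbert_schmidt A}"
  using hilbert_schmidt_0 by auto

setup_lifting type_definition_hs

lift_definition hs_apply :: "'h::{real_inner, second_countable_topology} hs \<Rightarrow> 'h \<Rightarrow> 'h"
  is blinfun_apply .

instantiation hs :: ("{real_inner, second_countable_topology}") real_vector
begin

lift_definition zero_hs :: "'a hs" is 0 by (rule hilbert_schmidt_0)
lift_definition plus_hs :: "'a hs \<Rightarrow> 'a hs \<Rightarrow> 'a hs" is "(+)" by (rule hilbert_schmidt_add)
lift_definition scaleR_hs :: "real \<Rightarrow> 'a hs \<Rightarrow> 'a hs" is "(*\<^sub>R)" by (rule hilbert_schmidt_scaleR)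
lift_definition uminus_hs :: "'a hs \<Rightarrow> 'a hs" is uminus
  using hilbert_schmidt_scaleR[of _ "-1"] by simp
lift_definition minus_hs :: "'a hs \<Rightarrow> 'a hs \<Rightarrow> 'a hs" is "(-)"
proof -
  fix A B :: "'a \<Rightarrow>\<^sub>L 'a" assume "hilbert_schmidt A" "hilbert_schmidt B"
  then show "hilbert_schmidt (A - B)"
    using hilbert_schmidt_add[of A "(-1) *\<^sub>R B"] hilbert_schmidt_scaleR[of B "-1"] by simp
qed

instance
proof
  fix A B C :: "'a hs" and a b :: real
  show "A + B + C = A + (B + C)" by transfer (rule add.assoc)
  show "A + B = B + A" by transfer (rule add.commute)
  show "0 + A = A" by transfer (rule add_0_left)
  show "- A + A = 0" by transfer (rule left_minus)
  show "A - B = A + - B" by transfer (rule diff_conv_add_uminus)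
  show "a *\<^sub>R (A + B) = a *\<^sub>R A + a *\<^sub>R B" by transfer (rule scaleR_right_distrib)
  show "(a + b) *\<^sub>R A = a *\<^sub>R A + b *\<^sub>R A" by transfer (rule scaleR_left_distrib)
  show "a *\<^sub>R b *\<^sub>R A = (a * b) *\<^sub>R A" by transfer (rule scaleR_scaleR)
  show "1 *\<^sub>R A = A" by transfer (rule scaleR_one)
qed

end

lemma hs_apply_add: "hs_apply (A + B) x = hs_apply A x + hs_apply B x"
  by transfer (simp add: blinfun.add_left)

lemma hs_apply_scaleR: "hs_apply (c *\<^sub>R A) x = c *\<^sub>R hs_apply A x"
  by transfer (simp add: blinfun.scaleR_left)

lemma summable_hs_norm: "orthonormal_basis B \<Longrightarrow> (\<lambda>e. (norm (hs_apply A e))\<^sup>2) summable_on B"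
  by transfer (simp add: hilbert_schmidt_iff)

lemma summable_hs_inner:
  assumes "orthonormal_basis B"
  shows "(\<lambda>e. inner (hs_apply A e) (hs_apply A' e)) summable_on B"
proof -
  have "(\<lambda>e. norm (inner (hs_apply A e) (hs_apply A' e))) summable_on B"
  proof (rule summable_on_comparison_test)
    show "(\<lambda>e. (norm (hs_apply A e))\<^sup>2 + (norm (hs_apply A' e))\<^sup>2) summable_on B"
      by (intro summable_on_add summable_hs_norm assms)
    fix e
    have "norm (inner (hs_apply A e) (hs_apply A' e)) \<le> norm (hs_apply A e) * norm (hs_apply A' e)"
      by (simp add: Cauchy_Schwarz_ineq2)
    also have "\<dots> \<le> (norm (hs_apply A e))\<^sup>2 + (norm (hs_apply A' e))\<^sup>2"
      using sum_squares_bound[of "norm (hs_apply A e)" "norm (hs_apply A' e)"]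
            mult_nonneg_nonneg[OF norm_ge_zero norm_ge_zero, of "hs_apply A e" "hs_apply A' e"]
      by linarith
    finally show "norm (inner (hs_apply A e) (hs_apply A' e)) \<le> \<dots>" .
  qed auto
  then show ?thesis by (rule abs_summable_summable)
qed

instantiation hs :: ("{real_inner, second_countable_topology}") real_inner
begin

definition inner_hs :: "'a hs \<Rightarrow> 'a hs \<Rightarrow> real" where
  "inner_hs A B = (\<Sum>\<^sub>\<infinity>e\<in>some_basis. inner (hs_apply A e) (hs_apply B e))"

definition norm_hs :: "'a hs \<Rightarrow> real" where
  "norm_hs A = sqrt (inner A A)"

definition dist_hs :: "'a hs \<Rightarrow> 'a hs \<Rightarrow> real" where
  "dist_hs A B = norm (A - B)"

definition sgn_hs :: "'a hs \<Rightarrow> 'a hs" where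
  "sgn_hs A = A /\<^sub>R norm A"

definition uniformity_hs :: "('a hs \<times> 'a hs) filter" where
  "uniformity_hs = (INF e\<in>{0<..}. principal {(A, B). dist A B < e})"

definition open_hs :: "'a hs set \<Rightarrow> bool" where
  "open_hs U = (\<forall>A\<in>U. \<forall>\<^sub>F (A', B) in uniformity. A' = A \<longrightarrow> B \<in> U)"

instance
proof
  fix A B C :: "'a hs" and a b :: real
  show "sgn A = A /\<^sub>R norm A" by (simp add: sgn_hs_def)
  show "dist A B = norm (A - B)" by (simp add: dist_hs_def)
  show "uniformity = (INF e\<in>{0<..}. principal {(A :: 'a hs, B). dist A B < e})"
    by (simp add: uniformity_hs_def)
  show "open U = (\<forall>A\<in>U. \<forall>\<^sub>F (A', B) in uniformity. A' = A \<longrightarrow> B \<in> U)" for U :: "'a hs set"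
    by (simp add: open_hs_def)
  show "inner A B = inner B A" by (simp add: inner_hs_def inner_commute)
  show "inner (A + B) C = inner A C + inner B C"
    by (simp add: inner_hs_def hs_apply_add inner_add_left infsum_add
          summable_hs_inner[OF some_basis])
  show "inner (a *\<^sub>R A) B = a * inner A B"
    by (simp add: inner_hs_def hs_apply_scaleR infsum_cmult_right
          summable_hs_inner[OF some_basis])
  show "0 \<le> inner A A" unfolding inner_hs_def by (intro infsum_nonneg) auto
  show "norm A = sqrt (inner A A)" by (simp add: norm_hs_def)
  show "inner A A = 0 \<longleftrightarrow> A = 0"
  proof
    assume "inner A A = 0"
    then have le: "(\<Sum>\<^sub>\<infinity>e\<in>some_basis. inner (hs_apply A e) (hs_apply A e)) \<le> 0"
      by (simp add: inner_hs_def)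
    have "inner (hs_apply A e) (hs_apply A e) = 0" if "e \<in> some_basis" for e
      by (rule nonneg_infsum_le_0D[OF le summable_hs_inner[OF some_basis] _ that]) simp
    then have z: "hs_apply A e = 0" if "e \<in> some_basis" for e
      using that by simp
    show "A = 0"
      using z
    proof transfer
      fix A :: "'a \<Rightarrow>\<^sub>L 'a"
      assume z: "\<And>e. e \<in> some_basis \<Longrightarrow> blinfun_apply A e = 0"
      have "blinfun_apply A x = 0" if "x \<in> span some_basis" for x
        using that by (induction rule: span_induct_alt)
          (auto simp: blinfun.add_right blinfun.scaleR_right z)
      moreover have "closed {x. blinfun_apply A x = 0}"
        by (intro closed_Collect_eq continuous_intros)
      ultimately have "closure (span some_basis) \<subseteq> {x. blinfun_apply A x = 0}"
        by (intro closure_minimal) auto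
      then show "A = 0"
        using some_basis by (intro blinfun_eqI) (auto simp: orthonormal_basis_def)
    qed
  qed (simp add: inner_hs_def zero_hs.rep_eq hs_apply.rep_eq)
qed

end
lemma has_sum_inner_hs:
  assumes "orthonormal_basis B"
  shows "((\<lambda>e. inner (hs_apply A e) (hs_apply A' e)) has_sum inner A A') B"
proof -
  have norm: "((\<lambda>e. (norm (hs_apply A e))\<^sup>2) has_sum (norm A)\<^sup>2) B" for A :: "'a hs"
  proof -
    have "((\<lambda>e. (norm (hs_apply A e))\<^sup>2) has_sum inner A A) some_basis"
      unfolding inner_hs_def power2_norm_eq_inner
      by (intro has_sum_infsum summable_hs_inner some_basis)
    then show ?thesis
      unfolding hs_apply.rep_eq power2_norm_eq_inner[of A]
      by (rule has_sum_norm_change_basis[OF some_basis assms])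
  qed
  have "((\<lambda>e. 1/4 * ((norm (hs_apply (A + A') e))\<^sup>2 + - 1 * (norm (hs_apply (A + (- 1) *\<^sub>R A') e))\<^sup>2))
     has_sum 1/4 * ((norm (A + A'))\<^sup>2 + - 1 * (norm (A + (- 1) *\<^sub>R A'))\<^sup>2)) B"
    by (intro has_sum_cmult_right has_sum_add norm)
  then show ?thesis
    by (simp add: hs_apply_add hs_apply_scaleR power2_norm_eq_inner algebra_simps inner_commute
        del: scaleR_minus_left scaleR_minus1_left)
qed

lift_definition tensor ::
    "'h::{real_inner, second_countable_topology} \<Rightarrow> 'h \<Rightarrow> 'h hs"  (infixr "\<otimes>" 70)
  is "\<lambda>y z. Blinfun (\<lambda>x. inner y x *\<^sub>R z)"
proof -
  fix y z :: 'h
  have bl: "bounded_linear (\<lambda>x. inner y x *\<^sub>R z)"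
    by (intro bounded_linear_intros)
  have "(\<lambda>e. (inner y e)\<^sup>2) summable_on some_basis"
    using has_sum_parseval[OF some_basis, of y] by (auto simp: summable_on_def)
  then show "hilbert_schmidt (Blinfun (\<lambda>x. inner y x *\<^sub>R z))"
    unfolding hilbert_schmidt_def bounded_linear_Blinfun_apply[OF bl]
    by (simp add: power_mult_distrib summable_on_cmult_left)
qed

lemma hs_apply_tensor: "hs_apply (y \<otimes> z) x = inner y x *\<^sub>R z"
  by transfer (simp add: bounded_linear_Blinfun_apply bounded_linear_intros)

definition symmetric_op :: "('h::real_inner \<Rightarrow> 'h) \<Rightarrow> bool" where
  "symmetric_op A \<longleftrightarrow> (\<forall>x y. inner (A x) y = inner x (A y))"

definition nonneg_definite :: "('h::real_inner \<Rightarrow> 'h) \<Rightarrow> bool" where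
  "nonneg_definite A \<longleftrightarrow> (\<forall>x. 0 \<le> inner (A x) x)"

text \<open>
  The sequences are indexed by \<open>j \<ge> 1\<close>; their value at \<open>0\<close> is irrelevant.  The last clause says
  that every nonzero eigenvalue is listed according to its multiplicity.  The \<open>v j\<close> need not span
  the kernel: an operator with infinitely many positive eigenvalues and a nontrivial kernel has
  no eigenbasis ordered by decreasing eigenvalues.
\<close>

definition ordered_eigensystem ::
    "('h::real_inner \<Rightarrow> 'h) \<Rightarrow> (nat \<Rightarrow> real) \<Rightarrow> (nat \<Rightarrow> 'h) \<Rightarrow> bool" where
  "ordered_eigensystem A l v \<longleftrightarrow>
     (\<forall>j\<ge>1. A (v j) = l j *\<^sub>R v j) \<and>
     (\<forall>j\<ge>1. \<forall>k\<ge>1. inner (v j) (v k) = (if j = k then 1 else 0)) \<and>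
     (\<forall>j\<ge>1. l (j + 1) \<le> l j) \<and>
     (\<forall>m x. m \<noteq> 0 \<longrightarrow> A x = m *\<^sub>R x \<longrightarrow> x \<in> span (v ` {j. 1 \<le> j \<and> l j = m}))"


section \<open>Random elements\<close>

definition covariance_operator ::
    "'w measure \<Rightarrow> ('w \<Rightarrow> 'h::{banach, real_inner, second_countable_topology}) \<Rightarrow> 'h \<Rightarrow> 'h" where
  "covariance_operator M X x =
     (let \<mu> = (\<integral>\<omega>. X \<omega> \<partial>M) in \<integral>\<omega>. inner (X \<omega> - \<mu>) x *\<^sub>R (X \<omega> - \<mu>) \<partial>M)"

definition random_element :: "'w measure \<Rightarrow> 'a topology \<Rightarrow> ('w \<Rightarrow> 'a) \<Rightarrow> bool" where
  "random_element M S Y \<longleftrightarrow> Y \<in> measurable M (sigma (topspace S) {U. openin S U})"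

text \<open>
  Convergence in distribution in the space \<open>S\<close>.  The limit \<open>Y\<close> may live on a probability space
  \<open>M'\<close> different from that of the \<open>Y\<^sub>N\<close>.  Measurability is part of the notion because
  the integral of a non-measurable function is \<open>0\<close> by convention.
\<close>

definition converges_in_distribution ::
    "'a topology \<Rightarrow> 'w measure \<Rightarrow> (nat \<Rightarrow> 'w \<Rightarrow> 'a) \<Rightarrow> 'u measure \<Rightarrow> ('u \<Rightarrow> 'a) \<Rightarrow> bool" where
  "converges_in_distribution S M Y\<^sub>N M' Y \<longleftrightarrow>
     (\<forall>N. random_element M S (Y\<^sub>N N)) \<and> random_element M' S Y \<and>
     (\<forall>f :: 'a \<Rightarrow> real. continuous_map S euclideanreal f \<and> bounded (f ` topspace S) \<longrightarrow>
        (\<lambda>N. \<integral>\<omega>. f (Y\<^sub>N N \<omega>) \<partial>M) \<longlonglongrightarrow> (\<integral>\<omega>. f (Y \<omega>) \<partial>M'))"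

text \<open>The space \<open>V\<^sup>p\<close>, as functions on \<open>{1..p}\<close>.\<close>

abbreviation power_space :: "nat \<Rightarrow> (nat \<Rightarrow> 'a::topological_space) topology" where
  "power_space p \<equiv> product_topology (\<lambda>_. euclidean) {1..p}"

end

theory Submission
  imports Defs
begin

text \<open>
  The argument is a first order Taylor expansion whose remainder is controlled by the size of the
  perturbation \<open>D = C_hat - C\<close>, followed by the delta method.

  Let \<open>g\<close> be a lower bound for the gaps between consecutive ones among the first \<open>p + 1\<close> eigenvalues
  of \<open>C\<close>, and let \<open>R j\<close> be the reduced resolvent of \<open>C\<close> at \<open>lam j\<close>; its norm is at most \<open>1 / g\<close>.  If
  the norm of \<open>D\<close> is at most \<open>g / 8\<close>, the eigenvalue equation for \<open>C + D\<close> near \<open>(lam j, v j)\<close> is a fixed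
  point problem for a contraction (\<open>perturbed_eigenpair\<close>).  This gives an eigenpair of \<open>C_hat\<close> that
  agrees with \<open>lam j + \<langle>D (v j), v j\<rangle>\<close> and \<open>v j + R j (D (v j))\<close> up to terms of order \<open>\<parallel>D\<parallel>\<^sup>2\<close>.  One half
  of Weyl's inequality (\<open>eigenvalue_perturbation_le\<close>) bounds the eigenvalues of \<open>C_hat\<close> from above, so
  that this pair must be the \<open>j\<close>-th one in the ordered eigensystem of \<open>C_hat\<close>, up to normalization;
  the sign convention settles the sign, and normalizing costs only a second order term
  (\<open>eigensystem_expansion\<close>).  All this is deterministic.

  Multiply by \<open>r N\<close>: with \<open>Z_N = r N (C_hat - C)\<close>, the rescaled errors are \<open>R j (Z_N (v j))\<close> and
  \<open>\<langle>Z_N (v j), v j\<rangle>\<close> up to a remainder of order \<open>\<parallel>Z_N\<parallel>\<^sup>2 / r N\<close>.  As \<open>Z_N\<close> converges in distribution,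
  its norm is bounded in probability, and the remainder tends to \<open>0\<close> in probability.  The leading terms
  are continuous functions of \<open>Z_N\<close>, so they converge jointly to the same functions of \<open>Z\<close>, and
  Slutsky's lemma carries this over to the errors themselves
  (\<open>converges_in_distribution_first_order\<close>).  Finally \<open>R j (Z (v j))\<close> is the series \<open>T j\<close>.
\<close>

section \<open>Expansions along an orthonormal basis\<close>

lemma has_sum_single_term:
  fixes f :: "'i \<Rightarrow> real"
  assumes "(f has_sum s) I" "k \<in> I" "\<And>l. l \<in> I \<Longrightarrow> l \<noteq> k \<Longrightarrow> f l = 0"
  shows "s = f k"
proof -
  have "(f has_sum f k) I \<longleftrightarrow> (f has_sum f k) {k}"
    by (rule has_sum_cong_neutral) (use assms in auto)
  moreover have "(f has_sum f k) {k}" by (rule has_sum_finiteI) auto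
  ultimately show ?thesis using assms(1) has_sum_unique by blast
qed

text \<open>
  The index set matters: the eigenvectors of the theorem are numbered from \<open>1\<close>, and its sums
  run over the numbers, not over the vectors.
\<close>

locale indexed_basis =
  fixes v :: "'i \<Rightarrow> 'h::real_inner" and I :: "'i set"
  assumes inner_basis: "j \<in> I \<Longrightarrow> k \<in> I \<Longrightarrow> inner (v j) (v k) = (if j = k then 1 else 0)"
    and basis: "orthonormal_basis (v ` I)"
begin

lemma inj_basis: "inj_on v I"
  using inner_basis by (metis inj_onI zero_neq_one)

lemma norm_basis: "k \<in> I \<Longrightarrow> norm (v k) = 1"
  by (simp add: norm_eq_sqrt_inner inner_basis)

lemma parseval: "((\<lambda>k. (inner x (v k))\<^sup>2) has_sum (norm x)\<^sup>2) I"
  using has_sum_parseval[OF basis, of x]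
  unfolding has_sum_reindex[OF inj_basis] by (simp add: o_def)

lemma norm_sum_basis:
  assumes "finite F" "F \<subseteq> I"
  shows "(norm (\<Sum>k\<in>F. a k *\<^sub>R v k))\<^sup>2 = (\<Sum>k\<in>F. (a k)\<^sup>2)"
proof -
  have "(norm (\<Sum>k\<in>F. a k *\<^sub>R v k))\<^sup>2 = (\<Sum>k\<in>F. \<Sum>l\<in>F. a k * (a l * inner (v k) (v l)))"
    by (simp add: power2_norm_eq_inner inner_sum_left inner_sum_right sum_distrib_left inner_commute mult_ac)
  also have "\<dots> = (\<Sum>k\<in>F. \<Sum>l\<in>F. if k = l then (a k)\<^sup>2 else 0)"
    using assms by (intro sum.cong refl) (auto simp: inner_basis power2_eq_square subset_iff)
  finally show ?thesis using assms by simp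
qed

text \<open>
  By orthogonality the squared distance from \<open>x\<close> to a partial sum is the corresponding tail of
  Parseval's series.
\<close>

lemma has_sum_expansion: "((\<lambda>k. inner x (v k) *\<^sub>R v k) has_sum x) I"
proof -
  have rest: "(norm (x - (\<Sum>k\<in>F. inner x (v k) *\<^sub>R v k)))\<^sup>2 = (norm x)\<^sup>2 - (\<Sum>k\<in>F. (inner x (v k))\<^sup>2)"
    if F: "finite F" "F \<subseteq> I" for F
  proof -
    let ?s = "\<Sum>k\<in>F. inner x (v k) *\<^sub>R v k"
    have "inner x ?s = (\<Sum>k\<in>F. (inner x (v k))\<^sup>2)"
      by (simp add: inner_sum_right power2_eq_square)
    moreover have "inner ?s ?s = (\<Sum>k\<in>F. (inner x (v k))\<^sup>2)"
      using norm_sum_basis[OF F] by (simp add: power2_norm_eq_inner)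
    ultimately show ?thesis
      by (simp add: power2_norm_eq_inner inner_diff_left inner_diff_right inner_commute)
  qed
  have "((\<lambda>F. (norm x)\<^sup>2 - (\<Sum>k\<in>F. (inner x (v k))\<^sup>2)) \<longlongrightarrow> (norm x)\<^sup>2 - (norm x)\<^sup>2) (finite_subsets_at_top I)"
    using parseval[of x] unfolding has_sum_def by (intro tendsto_diff tendsto_const)
  then have "((\<lambda>F. sqrt ((norm x)\<^sup>2 - (\<Sum>k\<in>F. (inner x (v k))\<^sup>2))) \<longlongrightarrow> sqrt 0) (finite_subsets_at_top I)"
    by (intro tendsto_real_sqrt) simp
  moreover have "\<forall>\<^sub>F F in finite_subsets_at_top I.
      sqrt ((norm x)\<^sup>2 - (\<Sum>k\<in>F. (inner x (v k))\<^sup>2)) = dist (\<Sum>k\<in>F. inner x (v k) *\<^sub>R v k) x"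
    by (intro eventually_finite_subsets_at_top_weakI)
       (simp add: rest[symmetric] dist_norm norm_minus_commute)
  ultimately have "((\<lambda>F. dist (\<Sum>k\<in>F. inner x (v k) *\<^sub>R v k) x) \<longlongrightarrow> 0) (finite_subsets_at_top I)"
    by (simp add: tendsto_cong)
  then show ?thesis unfolding has_sum_def by (subst tendsto_dist_iff)
qed

lemma has_sum_linear_image:
  assumes "bounded_linear \<phi>"
  shows "((\<lambda>k. inner x (v k) *\<^sub>R \<phi> (v k)) has_sum \<phi> x) I"
  using has_sum_bounded_linear[OF assms has_sum_expansion, of x]
  by (simp add: o_def linear_cmul[OF bounded_linear.linear[OF assms]])

lemma eq_if_coordinates_eq:
  assumes "\<And>k. k \<in> I \<Longrightarrow> inner x (v k) = inner y (v k)"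
  shows "x = y"
proof -
  have "((\<lambda>k. inner x (v k) *\<^sub>R v k) has_sum y) I"
    using has_sum_expansion[of y] by (rule has_sum_cong[THEN iffD1, rotated]) (use assms in auto)
  then show ?thesis using has_sum_expansion has_sum_unique by blast
qed

end

text \<open>
  By Pythagoras, the Cauchy criterion for a series of multiples of the \<open>v k\<close> is the Cauchy criterion
  for the series of the squared coefficients; completeness of the space does the rest.
\<close>

lemma (in indexed_basis) summable_on_square_summable:
  assumes complete: "uniform_space_class.complete (UNIV :: 'h set)" and a: "(\<lambda>k. (a k)\<^sup>2) summable_on I"
  shows "(\<lambda>k. a k *\<^sub>R v k) summable_on I"
proof -
  obtain S where S: "((\<lambda>k. (a k)\<^sup>2) has_sum S) I" using a by (auto simp: summable_on_def)
  have "cauchy_filter (filtermap (sum (\<lambda>k. a k *\<^sub>R v k)) (finite_subsets_at_top I))"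
    unfolding cauchy_filter_metric_filtermap
  proof (intro allI impI)
    fix e :: real assume e: "0 < e"
    have "\<forall>\<^sub>F F in finite_subsets_at_top I. dist (\<Sum>k\<in>F. (a k)\<^sup>2) S < (e/2)\<^sup>2"
      using S e unfolding has_sum_def by (intro tendstoD) auto
    then obtain F0 where F0: "finite F0" "F0 \<subseteq> I"
      and small: "dist (\<Sum>k\<in>F0. (a k)\<^sup>2) S < (e/2)\<^sup>2"
      unfolding eventually_finite_subsets_at_top by (metis order_refl)
    have tail: "dist (\<Sum>k\<in>F. a k *\<^sub>R v k) (\<Sum>k\<in>F0. a k *\<^sub>R v k) < e/2"
      if F: "finite F" "F0 \<subseteq> F" "F \<subseteq> I" for F
    proof -
      have "(\<Sum>k\<in>F. a k *\<^sub>R v k) - (\<Sum>k\<in>F0. a k *\<^sub>R v k) = (\<Sum>k\<in>F - F0. a k *\<^sub>R v k)"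
        using sum_diff[OF F(1,2)] by metis
      then have "(dist (\<Sum>k\<in>F. a k *\<^sub>R v k) (\<Sum>k\<in>F0. a k *\<^sub>R v k))\<^sup>2 = (\<Sum>k\<in>F - F0. (a k)\<^sup>2)"
        using norm_sum_basis[of "F - F0" a] F by (auto simp: dist_norm)
      also have "\<dots> = (\<Sum>k\<in>F. (a k)\<^sup>2) - (\<Sum>k\<in>F0. (a k)\<^sup>2)"
        using sum_diff[OF F(1,2)] by metis
      also have "\<dots> < (e/2)\<^sup>2"
      proof -
        have "(\<Sum>k\<in>F. (a k)\<^sup>2) \<le> S"
          using has_sum_mono2[OF has_sum_finite[OF F(1)] S F(3)] by simp
        then show ?thesis using small by (auto simp: dist_real_def)
      qed
      finally show ?thesis by (rule power_less_imp_less_base) (use e in simp)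
    qed
    show "\<exists>P. eventually P (finite_subsets_at_top I) \<and>
        (\<forall>F F'. P F \<and> P F' \<longrightarrow> dist (\<Sum>k\<in>F. a k *\<^sub>R v k) (\<Sum>k\<in>F'. a k *\<^sub>R v k) < e)"
    proof (intro exI conjI allI impI)
      show "\<forall>\<^sub>F F in finite_subsets_at_top I. finite F \<and> F0 \<subseteq> F \<and> F \<subseteq> I"
        unfolding eventually_finite_subsets_at_top using F0 by blast
    next
      fix F F' assume *: "(finite F \<and> F0 \<subseteq> F \<and> F \<subseteq> I) \<and> (finite F' \<and> F0 \<subseteq> F' \<and> F' \<subseteq> I)"
      show "dist (\<Sum>k\<in>F. a k *\<^sub>R v k) (\<Sum>k\<in>F'. a k *\<^sub>R v k) < e"
        using dist_triangle_half_l[OF tail[of F] tail[of F']] * by blast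
    qed
  qed
  then obtain L where "(sum (\<lambda>k. a k *\<^sub>R v k) \<longlongrightarrow> L) (finite_subsets_at_top I)"
    using complete complete_uniform[where S="UNIV :: 'h set"] by (force simp: filterlim_def)
  then show ?thesis unfolding summable_on_def has_sum_def by blast
qed

section \<open>Diagonal operators\<close>

definition diagonal_op :: "('i \<Rightarrow> 'h::real_inner) \<Rightarrow> 'i set \<Rightarrow> ('i \<Rightarrow> real) \<Rightarrow> 'h \<Rightarrow> 'h" where
  "diagonal_op v I c x = (\<Sum>\<^sub>\<infinity>k\<in>I. (c k * inner x (v k)) *\<^sub>R v k)"

locale bounded_diagonal = indexed_basis v I
  for v :: "'i \<Rightarrow> 'h::{real_inner, banach}" and I +
  fixes c :: "'i \<Rightarrow> real" and s :: real
  assumes bound: "k \<in> I \<Longrightarrow> \<bar>c k\<bar> \<le> s" and s_nonneg: "0 \<le> s"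
begin

lemma coefficient_bound: "k \<in> I \<Longrightarrow> (c k * inner x (v k))\<^sup>2 \<le> s\<^sup>2 * (inner x (v k))\<^sup>2"
  using bound[of k] s_nonneg by (auto simp: power_mult_distrib intro!: mult_right_mono power2_le_iff_abs_le[THEN iffD2])

lemma has_sum_diagonal_op: "((\<lambda>k. (c k * inner x (v k)) *\<^sub>R v k) has_sum diagonal_op v I c x) I"
proof -
  have "(\<lambda>k. (c k * inner x (v k))\<^sup>2) summable_on I"
  proof (rule summable_on_comparison_test)
    show "(\<lambda>k. s\<^sup>2 * (inner x (v k))\<^sup>2) summable_on I"
      using parseval by (intro summable_on_cmult_right) (auto simp: summable_on_def)
  qed (use coefficient_bound in auto)
  moreover have "uniform_space_class.complete (UNIV :: 'h set)"
    unfolding complete_def using Cauchy_convergent convergent_def by blast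
  ultimately show ?thesis
    unfolding diagonal_op_def by (intro has_sum_infsum summable_on_square_summable)
qed

lemma inner_diagonal_op:
  assumes "k \<in> I"
  shows "inner (diagonal_op v I c x) (v k) = c k * inner x (v k)"
proof -
  have "((\<lambda>l. inner ((c l * inner x (v l)) *\<^sub>R v l) (v k)) has_sum inner (diagonal_op v I c x) (v k)) I"
    using has_sum_bounded_linear[OF bounded_linear_inner_left has_sum_diagonal_op, of x "v k"] by (simp add: o_def)
  from has_sum_single_term[OF this assms] show ?thesis using assms by (simp add: inner_basis)
qed

lemma norm_diagonal_op_le: "norm (diagonal_op v I c x) \<le> s * norm x"
proof -
  have "((\<lambda>k. (c k * inner x (v k))\<^sup>2) has_sum (norm (diagonal_op v I c x))\<^sup>2) I"
    using parseval[of "diagonal_op v I c x"]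
    by (rule has_sum_cong[THEN iffD1, rotated]) (simp add: inner_diagonal_op)
  then have "(norm (diagonal_op v I c x))\<^sup>2 \<le> s\<^sup>2 * (norm x)\<^sup>2"
    by (rule has_sum_mono[OF _ has_sum_cmult_right[OF parseval]]) (rule coefficient_bound)
  then show ?thesis
    by (intro power2_le_imp_le[where x = "norm _"]) (use s_nonneg in \<open>auto simp: power_mult_distrib\<close>)
qed

lemma bounded_linear_diagonal_op: "bounded_linear (diagonal_op v I c)"
proof (rule bounded_linear_intro)
  show "diagonal_op v I c (x + y) = diagonal_op v I c x + diagonal_op v I c y" for x y
    by (rule eq_if_coordinates_eq) (simp add: inner_diagonal_op inner_add_left algebra_simps)
  show "diagonal_op v I c (r *\<^sub>R x) = r *\<^sub>R diagonal_op v I c x" for r x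
    by (rule eq_if_coordinates_eq) (simp add: inner_diagonal_op)
  show "norm (diagonal_op v I c x) \<le> norm x * s" for x
    using norm_diagonal_op_le[of x] by (simp add: mult.commute)
qed

end

section \<open>Hilbert--Schmidt operators\<close>

lemma bounded_linear_hs_apply: "bounded_linear (hs_apply A)"
  by transfer (rule blinfun.bounded_linear_right)

lemma hs_apply_diff: "hs_apply (A - B) x = hs_apply A x - hs_apply B x"
  by transfer (simp add: blinfun.diff_left)

text \<open>
  The general rule behind the coefficients of the limit \<open>T j\<close>: testing against \<open>v j \<otimes> v k\<close> reads off
  the matrix entry of the operator at \<open>v j\<close>, \<open>v k\<close>.  Both sides are expanded along the same basis.
\<close>

lemma inner_tensor: "inner A (y \<otimes> z) = inner (hs_apply A y) z"
proof -
  interpret indexed_basis "\<lambda>e. e" "some_basis :: 'a set"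
    using some_basis by unfold_locales (auto simp: orthonormal_basis_def orthonormal_inner)
  have "((\<lambda>e. inner y e *\<^sub>R inner (hs_apply A e) z) has_sum inner (hs_apply A y) z) some_basis"
    by (intro has_sum_linear_image bounded_linear_intros bounded_linear_hs_apply)
  then show ?thesis
    using has_sum_inner_hs[OF some_basis, of A "y \<otimes> z"] has_sum_unique
    by (fastforce simp: hs_apply_tensor)
qed

text \<open>
  The operator norm is at most the Hilbert--Schmidt norm: apply Cauchy--Schwarz in the
  Hilbert--Schmidt space to \<open>A\<close> and the rank-one operator \<open>x \<otimes> A x\<close>.
\<close>

lemma norm_hs_apply_le: "norm (hs_apply A x) \<le> norm A * norm x"
proof -
  let ?y = "hs_apply A x"
  have "(norm (x \<otimes> ?y))\<^sup>2 = (norm x * norm ?y)\<^sup>2"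
    unfolding power2_norm_eq_inner[of "x \<otimes> ?y"] inner_tensor
    by (simp add: hs_apply_tensor dot_square_norm power_mult_distrib)
  then have "norm (x \<otimes> ?y) = norm x * norm ?y"
    by (rule power2_eq_imp_eq) auto
  then have "norm ?y * norm ?y \<le> (norm A * norm x) * norm ?y"
    using Cauchy_Schwarz_ineq2[of A "x \<otimes> ?y"]
    by (simp add: inner_tensor dot_square_norm power2_eq_square mult_ac)
  then show ?thesis by (cases "norm ?y = 0") auto
qed

lemma bounded_linear_hs_apply_left: "bounded_linear (\<lambda>A. hs_apply A x)"
  by (rule bounded_linear_intro[where K = "norm x"])
     (simp_all add: hs_apply_add hs_apply_scaleR norm_hs_apply_le)

section \<open>Perturbation of a simple eigenvalue\<close>

text \<open>
  An operator with an orthonormal eigenbasis is symmetric; this is the symmetry against a basis vector.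
\<close>

lemma (in indexed_basis) inner_diagonalizable:
  assumes "bounded_linear A" "\<And>k. k \<in> I \<Longrightarrow> A (v k) = l k *\<^sub>R v k" "k \<in> I"
  shows "inner (A x) (v k) = l k * inner x (v k)"
proof -
  have "bounded_linear (\<lambda>y. inner (A y) (v k))"
    by (rule bounded_linear_inner_left_comp[OF assms(1)])
  from has_sum_single_term[OF has_sum_linear_image[OF this, of x, unfolded real_scaleR_def] \<open>k \<in> I\<close>]
  show ?thesis using assms(2,3) by (simp add: inner_basis)
qed

text \<open>
  The easy half of the variational principle: a vector without components along the eigenvectors of
  eigenvalues above \<open>m\<close> has Rayleigh quotient at most \<open>m\<close>.
\<close>

lemma (in indexed_basis) quadratic_form_le:
  assumes A: "bounded_linear A" and eigen: "\<And>k. k \<in> I \<Longrightarrow> A (v k) = l k *\<^sub>R v k"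
    and bound: "\<And>k. k \<in> I \<Longrightarrow> inner x (v k) \<noteq> 0 \<Longrightarrow> l k \<le> m"
  shows "inner (A x) x \<le> m * (norm x)\<^sup>2"
proof (rule has_sum_mono)
  have bl: "bounded_linear (\<lambda>y. inner (A y) x)"
    by (rule bounded_linear_inner_left_comp[OF A])
  show "((\<lambda>k. inner x (v k) * inner (A (v k)) x) has_sum inner (A x) x) I"
    using has_sum_linear_image[OF bl, of x] by simp
  show "((\<lambda>k. m * (inner x (v k))\<^sup>2) has_sum m * (norm x)\<^sup>2) I"
    by (intro has_sum_cmult_right parseval)
  fix k assume k: "k \<in> I"
  have "l k * (inner x (v k))\<^sup>2 \<le> m * (inner x (v k))\<^sup>2"
    using bound[OF k] by (cases "inner x (v k) = 0") (auto intro: mult_right_mono)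
  then show "inner x (v k) * inner (A (v k)) x \<le> m * (inner x (v k))\<^sup>2"
    by (simp add: eigen[OF k] inner_commute power2_eq_square mult_ac)
qed

text \<open>
  The inverse of \<open>l j - A\<close> on the orthogonal complement of the eigenvector \<open>v j\<close>, extended by \<open>0\<close>
  to \<open>v j\<close>, where \<open>A\<close> has the eigenvalues \<open>l\<close>.  It is the derivative of the eigenvector: to first
  order a perturbation \<open>D\<close> moves \<open>v j\<close> by the reduced resolvent of \<open>D (v j)\<close>.
\<close>

definition reduced_resolvent ::
    "('i \<Rightarrow> 'h::real_inner) \<Rightarrow> 'i set \<Rightarrow> ('i \<Rightarrow> real) \<Rightarrow> 'i \<Rightarrow> 'h \<Rightarrow> 'h" where
  "reduced_resolvent v I l j = diagonal_op v I (\<lambda>k. if k = j then 0 else inverse (l j - l k))"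

lemma bounded_diagonal_reduced_resolvent:
  fixes v :: "'i \<Rightarrow> 'h::{real_inner, banach}"
  assumes "indexed_basis v I" "0 < g" "\<And>k. k \<in> I \<Longrightarrow> k \<noteq> j \<Longrightarrow> g \<le> \<bar>l j - l k\<bar>"
  shows "bounded_diagonal v I (\<lambda>k. if k = j then 0 else inverse (l j - l k)) (1 / g)"
proof -
  interpret indexed_basis v I by fact
  show ?thesis
    using assms(2,3)
    by unfold_locales (auto simp: abs_inverse divide_inverse intro!: le_imp_inverse_le)
qed

lemma bounded_linear_reduced_resolvent:
  fixes v :: "'i \<Rightarrow> 'h::{real_inner, banach}"
  assumes "indexed_basis v I" "0 < g" "\<And>k. k \<in> I \<Longrightarrow> k \<noteq> j \<Longrightarrow> g \<le> \<bar>l j - l k\<bar>"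
  shows "bounded_linear (reduced_resolvent v I l j)"
  unfolding reduced_resolvent_def
  by (rule bounded_diagonal.bounded_linear_diagonal_op[OF
        bounded_diagonal_reduced_resolvent[where l = l, OF assms]])

text \<open>
  Look for an eigenvector of \<open>A + D\<close> of the form \<open>v j + u\<close> with \<open>u\<close> orthogonal to \<open>v j\<close>.  The
  \<open>v j\<close>-coordinate of the eigenvalue equation says that the eigenvalue is \<open>l j + \<nu>\<close> with
  \<open>\<nu> = \<langle>D (v j + u), v j\<rangle>\<close>; the other coordinates say that \<open>u\<close> is a fixed point of
  \<open>u \<mapsto> R (D (v j + u) - \<nu> u)\<close>, where \<open>R\<close> is the reduced resolvent.  Since \<open>R\<close> has norm at most
  \<open>1 / g\<close>, while \<open>\<parallel>D (v j + u)\<parallel>\<close> and \<open>\<bar>\<nu>\<bar>\<close> are at most \<open>2 d\<close> on the unit ball, the map has norm and Lipschitz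
  constant at most \<open>4 d / g\<close> there; this is at most \<open>1/2\<close> if \<open>8 d \<le> g\<close>, and Banach's theorem gives \<open>u\<close>.
  Putting the bound \<open>\<parallel>u\<parallel> \<le> 4 d / g\<close> back into the equation gives the two expansions.
\<close>

lemma perturbed_eigenpair:
  fixes v :: "'i \<Rightarrow> 'h::{real_inner, banach}"
  assumes basis: "indexed_basis v I"
    and A: "bounded_linear A" "\<And>k. k \<in> I \<Longrightarrow> A (v k) = l k *\<^sub>R v k"
    and j: "j \<in> I"
    and gap: "0 < g" "\<And>k. k \<in> I \<Longrightarrow> k \<noteq> j \<Longrightarrow> g \<le> \<bar>l j - l k\<bar>"
    and D: "bounded_linear D" "\<And>x. norm (D x) \<le> d * norm x"
    and d: "0 \<le> d" "8 * d \<le> g"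
  obtains u \<mu> where
    "inner u (v j) = 0"
    "A (v j + u) + D (v j + u) = \<mu> *\<^sub>R (v j + u)"
    "norm u \<le> 4 * (d / g)"
    "norm (u - reduced_resolvent v I l j (D (v j))) \<le> 12 * (d / g)\<^sup>2"
    "\<bar>\<mu> - l j\<bar> \<le> 2 * d"
    "\<bar>\<mu> - l j - inner (D (v j)) (v j)\<bar> \<le> 4 * d * (d / g)"
proof -
  let ?R = "reduced_resolvent v I l j"
  interpret bounded_diagonal v I "\<lambda>k. if k = j then 0 else inverse (l j - l k)" "1 / g"
    by (rule bounded_diagonal_reduced_resolvent[where l=l, OF basis gap])
  interpret D: bounded_linear D by (rule D)
  interpret A: bounded_linear A by (rule A)
  interpret R: bounded_linear ?R
    unfolding reduced_resolvent_def by (rule bounded_linear_diagonal_op)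
  have normR: "norm (?R x) \<le> b / g" if "norm x \<le> b" for x b
    using norm_diagonal_op_le[of x] that gap(1)
    unfolding reduced_resolvent_def by (auto simp: divide_simps intro: order_trans)
  have [simp]: "norm (v j) = 1" by (rule norm_basis[OF j])
  have le_norm: "\<bar>inner x (v j)\<bar> \<le> norm x" for x
    using Cauchy_Schwarz_ineq2[of x "v j"] by simp
  \<comment> \<open>the displacement of the eigenvalue that belongs to a candidate \<open>u\<close>, and the fixed point map\<close>
  define \<nu> where "\<nu> u = inner (D (v j + u)) (v j)" for u
  define F where "F u = ?R (D (v j + u) - \<nu> u *\<^sub>R u)" for u
  have D2: "norm (D (v j + u)) \<le> 2 * d" if "norm u \<le> 1" for u
  proof -
    have "norm (D (v j + u)) \<le> d * norm (v j + u)" by (rule D)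
    also have "\<dots> \<le> d * 2"
      using norm_triangle_ineq[of "v j" u] that d(1) by (intro mult_left_mono) auto
    finally show ?thesis by simp
  qed
  have \<nu>2: "\<bar>\<nu> u\<bar> \<le> 2 * d" if "norm u \<le> 1" for u
    unfolding \<nu>_def using le_norm D2[OF that] order_trans by blast
  have F_small: "norm (F u) \<le> 4 * (d / g)" if "norm u \<le> 1" for u
  proof -
    have "\<bar>\<nu> u\<bar> * norm u \<le> 2 * d * 1"
      by (intro mult_mono \<nu>2 that) (use d in auto)
    then have "norm (D (v j + u) - \<nu> u *\<^sub>R u) \<le> 4 * d"
      using norm_triangle_ineq4[of "D (v j + u)" "\<nu> u *\<^sub>R u"] D2[OF that] by simp
    from normR[OF this] show ?thesis by (simp add: F_def)
  qed
  have dg: "d / g \<le> 1 / 8" using d gap(1) by (simp add: field_simps)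
  have contraction: "dist (F u) (F w) \<le> 1/2 * dist u w" if u: "norm u \<le> 1" and w: "norm w \<le> 1" for u w
  proof -
    have "F u - F w = ?R (D (u - w) - \<nu> u *\<^sub>R (u - w) - inner (D (u - w)) (v j) *\<^sub>R w)"
      unfolding F_def R.diff[symmetric]
      by (rule arg_cong[of _ _ ?R]) (simp add: \<nu>_def D.add D.diff algebra_simps inner_diff_left inner_add_left)
    moreover have "norm (D (u - w) - \<nu> u *\<^sub>R (u - w) - inner (D (u - w)) (v j) *\<^sub>R w) \<le> 4 * d * norm (u - w)"
    proof -
      have 1: "norm (D (u - w)) \<le> d * norm (u - w)" by (rule D)
      have 2: "\<bar>\<nu> u\<bar> * norm (u - w) \<le> 2 * d * norm (u - w)"
        by (intro mult_right_mono \<nu>2 u) auto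
      have 3: "\<bar>inner (D (u - w)) (v j)\<bar> * norm w \<le> d * norm (u - w) * 1"
        by (intro mult_mono order_trans[OF le_norm 1] w) (use d in auto)
      show ?thesis
        using norm_triangle_ineq4[of "D (u - w) - \<nu> u *\<^sub>R (u - w)" "inner (D (u - w)) (v j) *\<^sub>R w"]
          norm_triangle_ineq4[of "D (u - w)" "\<nu> u *\<^sub>R (u - w)"] 1 2 3 by simp
    qed
    ultimately have "norm (F u - F w) \<le> 4 * d * norm (u - w) / g" using normR by simp
    also have "\<dots> = 4 * (d / g) * norm (u - w)" by simp
    also have "\<dots> \<le> 1/2 * norm (u - w)"
      by (intro mult_right_mono) (use dg in linarith, simp)
    finally show ?thesis by (simp add: dist_norm)
  qed
  have "\<exists>!u\<in>cball 0 1. F u = u"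
  proof (rule Banach_fix)
    show "F ` cball 0 1 \<subseteq> cball 0 1"
    proof (rule image_subsetI)
      fix u :: 'h assume "u \<in> cball 0 1"
      then have "norm u \<le> 1" by simp
      from F_small[OF this] dg have "norm (F u) \<le> 1" by linarith
      then show "F u \<in> cball 0 1" by simp
    qed
    show "dist (F x) (F y) \<le> 1/2 * dist x y" if "x \<in> cball 0 1" "y \<in> cball 0 1" for x y
      using contraction that by simp
  qed (simp_all add: complete_eq_closed)
  then obtain u where "u \<in> cball 0 1" and Fu: "F u = u" by blast
  then have u1: "norm u \<le> 1" by simp
  have u: "norm u \<le> 4 * (d / g)" using F_small[OF u1] Fu by simp
  have uj: "inner u (v j) = 0"
    by (subst Fu[symmetric]) (simp add: F_def reduced_resolvent_def inner_diagonal_op[OF j])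
  have uk: "(l j - l k) * inner u (v k) = inner (D (v j + u)) (v k) - \<nu> u * inner u (v k)"
    if k: "k \<in> I" "k \<noteq> j" for k
  proof -
    have "inner u (v k) = inverse (l j - l k) * inner (D (v j + u) - \<nu> u *\<^sub>R u) (v k)"
      by (subst Fu[symmetric]) (simp add: F_def reduced_resolvent_def inner_diagonal_op[OF k(1)] k(2))
    then have "(l j - l k) * inner u (v k) = inner (D (v j + u) - \<nu> u *\<^sub>R u) (v k)"
      using gap(1) gap(2)[OF k] by auto
    then show ?thesis by (simp add: inner_diff_left)
  qed
  have Du: "norm (D u) \<le> 4 * d * (d / g)"
    using order_trans[OF D(2) mult_left_mono[OF u d(1)]] by (simp add: mult_ac)
  show thesis
  proof (rule that[of u "l j + \<nu> u"])
    show "inner u (v j) = 0" by (rule uj)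
    show "norm u \<le> 4 * (d / g)" by (rule u)
    show "A (v j + u) + D (v j + u) = (l j + \<nu> u) *\<^sub>R (v j + u)"
    proof (rule eq_if_coordinates_eq)
      fix k assume k: "k \<in> I"
      have "inner (A (v j + u)) (v k) = l k * inner (v j + u) (v k)"
        by (rule inner_diagonalizable[OF A k])
      then show "inner (A (v j + u) + D (v j + u)) (v k) = inner ((l j + \<nu> u) *\<^sub>R (v j + u)) (v k)"
        using uk[OF k] uj by (cases "k = j") (auto simp: \<nu>_def inner_add_left inner_basis j k algebra_simps)
    qed
    have "norm (D u - \<nu> u *\<^sub>R u) \<le> 12 * d * (d / g)"
    proof -
      have "\<bar>\<nu> u\<bar> * norm u \<le> (2 * d) * (4 * (d / g))"
        by (intro mult_mono \<nu>2 u1 u) (use d in auto)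
      then show ?thesis using norm_triangle_ineq4[of "D u" "\<nu> u *\<^sub>R u"] Du by simp
    qed
    moreover have "u - ?R (D (v j)) = ?R (D u - \<nu> u *\<^sub>R u)"
    proof -
      have "u - ?R (D (v j)) = F u - ?R (D (v j))" by (simp add: Fu)
      also have "\<dots> = ?R (D u - \<nu> u *\<^sub>R u)"
        unfolding F_def R.diff[symmetric] by (simp add: D.add)
      finally show ?thesis .
    qed
    ultimately have "norm (u - ?R (D (v j))) \<le> 12 * d * (d / g) / g"
      by (simp only: normR)
    then show "norm (u - ?R (D (v j))) \<le> 12 * (d / g)\<^sup>2" by (simp add: power2_eq_square)
    show "\<bar>l j + \<nu> u - l j\<bar> \<le> 2 * d" using \<nu>2[OF u1] by simp
    have "l j + \<nu> u - l j - inner (D (v j)) (v j) = inner (D u) (v j)"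
      by (simp add: \<nu>_def D.add inner_add_left)
    then show "\<bar>l j + \<nu> u - l j - inner (D (v j)) (v j)\<bar> \<le> 4 * d * (d / g)"
      using le_norm[of "D u"] Du by simp
  qed
qed

section \<open>Eigenvalues and eigenvectors of a perturbed operator\<close>

text \<open>
  The map \<open>x \<mapsto> \<Sum>k\<in>K. \<langle>x, k\<rangle> k\<close> takes its values in the span of \<open>K\<close>, so it cannot be injective on a
  span of larger dimension.  Its kernel is the orthogonal complement of \<open>K\<close>, because the inner product
  of \<open>x\<close> with its image is the sum of the \<open>\<langle>x, k\<rangle>\<^sup>2\<close>.
\<close>

lemma exists_orthogonal_in_span:
  fixes S K :: "'h::real_inner set"
  assumes S: "independent S" and K: "finite K" and card: "card K < card S"
  obtains x where "x \<in> span S" "x \<noteq> 0" "\<And>k. k \<in> K \<Longrightarrow> inner x k = 0"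
proof -
  define f where "f x = (\<Sum>k\<in>K. inner x k *\<^sub>R k)" for x
  have f: "linear f"
    by (rule linearI) (simp_all add: f_def inner_add_left scaleR_add_left sum.distrib scaleR_sum_right)
  have kernel: "inner x k = 0" if "f x = 0" "k \<in> K" for x k
  proof -
    have "inner x (f x) = (\<Sum>k\<in>K. (inner x k)\<^sup>2)"
      by (simp add: f_def inner_sum_right power2_eq_square)
    then have "(\<Sum>k\<in>K. (inner x k)\<^sup>2) = 0" using that by simp
    then show ?thesis using K that(2) by (simp add: sum_nonneg_eq_0_iff)
  qed
  have "\<not> inj_on f (span S)"
  proof
    assume inj: "inj_on f (span S)"
    have "f ` S \<subseteq> span K"
      unfolding f_def by (intro image_subsetI span_sum span_scale span_base)
    then have "card (f ` S) \<le> card K"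
      using independent_span_bound[OF K linear_independent_injective_image[OF f S inj]] by blast
    moreover have "card (f ` S) = card S"
      by (rule card_image[OF inj_on_subset[OF inj span_superset]])
    ultimately show False using card by simp
  qed
  then obtain x where "x \<in> span S" "x \<noteq> 0" "f x = 0"
    using linear_injective_on_subspace_0[OF f subspace_span, of S] by blast
  with kernel show thesis by (intro that) auto
qed

lemma ordered_eigensystem_antimono:
  assumes "ordered_eigensystem A l v" "1 \<le> i" "i \<le> k"
  shows "l k \<le> l i"
  using assms(3)
proof (induction k rule: dec_induct)
  case (step n)
  then have "l (n + 1) \<le> l n" using assms(1,2) by (simp add: ordered_eigensystem_def)
  with step show ?case by simp
qed simp

text \<open>
  One half of Weyl's inequality.  Some nonzero combination \<open>x\<close> of the first \<open>i\<close> eigenvectors of \<open>B\<close>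
  is orthogonal to the first \<open>i - 1\<close> eigenvectors of \<open>A\<close>.  Its Rayleigh quotient is at least \<open>m i\<close> for
  \<open>B\<close> and at most \<open>l i\<close> for \<open>A\<close>, and the two quotients differ by at most \<open>d\<close>.  Lower bounds for the
  eigenvalues of \<open>B\<close> come from the eigenpairs that the fixed point argument constructs.
\<close>

lemma eigenvalue_perturbation_le:
  fixes v w :: "nat \<Rightarrow> 'h::real_inner"
  assumes A: "ordered_eigensystem A l v" "bounded_linear A" "orthonormal_basis (v ` {1..})"
    and B: "ordered_eigensystem B m w" "linear B"
    and close: "\<And>x. norm (B x - A x) \<le> d * norm x"
    and i: "1 \<le> i"
  shows "m i \<le> l i + d"
proof -
  interpret indexed_basis v "{1..}"
    using A by unfold_locales (auto simp: ordered_eigensystem_def)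
  have orth: "inner (w j) (w k) = (if j = k then 1 else 0)" if "1 \<le> j" "1 \<le> k" for j k
    using B that by (auto simp: ordered_eigensystem_def)
  have eigen: "A (v k) = l k *\<^sub>R v k" "B (w k) = m k *\<^sub>R w k" if "1 \<le> k" for k
    using A B that by (auto simp: ordered_eigensystem_def)
  have inj: "inj_on w {1..i}"
    using orth by (metis atLeastAtMost_iff inj_onI zero_neq_one)
  have independent: "independent (w ` {1..i})"
    using orth by (intro pairwise_orthogonal_independent)
      (auto simp: pairwise_def orthogonal_def, metis inner_zero_left zero_neq_one)
  have card: "card (v ` {1..<i}) < card (w ` {1..i})"
    unfolding card_image[OF inj] using i card_image_le[of "{1..<i}" v] by simp
  obtain x where x: "x \<in> span (w ` {1..i})" "x \<noteq> 0"
    and x_orth: "\<And>y. y \<in> v ` {1..<i} \<Longrightarrow> inner x y = 0"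
    by (rule exists_orthogonal_in_span[OF independent _ card]) auto
  obtain c where c: "x = (\<Sum>k\<in>{1..i}. c k *\<^sub>R w k)"
  proof -
    obtain c where "x = (\<Sum>y\<in>w ` {1..i}. c y *\<^sub>R y)"
      using x(1) by (auto simp: span_finite)
    then show thesis
      unfolding sum.reindex[OF inj] o_def by (rule that)
  qed
  have inner_w: "inner x (w k) = c k" if "k \<in> {1..i}" for k
    unfolding c inner_sum_left using that by (simp add: orth if_distrib cong: if_cong)
  have Bx: "B x = (\<Sum>k\<in>{1..i}. (c k * m k) *\<^sub>R w k)"
    unfolding c linear_sum[OF B(2)] by (intro sum.cong) (auto simp: linear_cmul[OF B(2)] eigen)
  have "m i * (norm x)\<^sup>2 = m i * inner x (\<Sum>k\<in>{1..i}. c k *\<^sub>R w k)"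
    using c by (simp add: power2_norm_eq_inner)
  also have "\<dots> = (\<Sum>k\<in>{1..i}. m i * (c k)\<^sup>2)"
    by (simp add: inner_sum_right inner_w power2_eq_square sum_distrib_left del: sum.cl_ivl_Suc)
  also have "\<dots> \<le> (\<Sum>k\<in>{1..i}. m k * (c k)\<^sup>2)"
    using ordered_eigensystem_antimono[OF B(1)] by (intro sum_mono mult_right_mono) auto
  also have "\<dots> = inner (B x) x"
    unfolding Bx inner_sum_left
    by (intro sum.cong) (auto simp: inner_commute[of _ x] inner_w power2_eq_square mult_ac)
  also have "\<dots> = inner (A x) x + inner (B x - A x) x" by (simp add: inner_diff_left)
  also have "\<dots> \<le> l i * (norm x)\<^sup>2 + d * (norm x)\<^sup>2"
  proof (rule add_mono)
    show "inner (A x) x \<le> l i * (norm x)\<^sup>2"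
    proof (rule quadratic_form_le[OF A(2)])
      fix k assume k: "k \<in> {1..}" "inner x (v k) \<noteq> 0"
      then have "i \<le> k" using x_orth[of "v k"] by (meson atLeastLessThan_iff atLeast_iff imageI not_le)
      then show "l k \<le> l i" by (rule ordered_eigensystem_antimono[OF A(1) i])
    qed (use eigen in auto)
    have "inner (B x - A x) x \<le> norm (B x - A x) * norm x" by (rule norm_cauchy_schwarz)
    also have "\<dots> \<le> (d * norm x) * norm x" by (intro mult_right_mono close) auto
    finally show "inner (B x - A x) x \<le> d * (norm x)\<^sup>2" by (simp add: power2_eq_square)
  qed
  finally have "m i * (norm x)\<^sup>2 \<le> (l i + d) * (norm x)\<^sup>2" by (simp add: algebra_simps)
  then show ?thesis using x(2) by simp
qed

text \<open>
  The sign condition fixes \<open>w\<close> as the normalization of \<open>e + u\<close>, whose length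
  \<open>sqrt (1 + \<parallel>u\<parallel>\<^sup>2)\<close> exceeds \<open>1\<close> only by a quadratic term.  So normalizing does not change the first
  order expansion.
\<close>

lemma normalization_error:
  fixes e u w :: "'h::real_inner"
  assumes e: "norm e = 1" and u: "inner u e = 0"
    and w: "norm w = 1" "e + u = c *\<^sub>R w" and sign: "inner w e \<noteq> 0 \<Longrightarrow> 0 < inner w e"
  shows "norm (w - (e + u)) \<le> (norm u)\<^sup>2 / 2"
proof -
  have "c * inner w e = 1"
    using w(2) e u by (metis inner_add_left inner_scaleR_left add.right_neutral norm_eq_1)
  then have "0 < c" using sign by (metis mult_zero_right zero_less_mult_pos2 zero_less_one zero_neq_one)
  then have c: "c = norm (e + u)" using w by simp
  have "c\<^sup>2 = 1 + (norm u)\<^sup>2"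
    unfolding c power2_norm_eq_inner using e u by (simp add: inner_add_left inner_add_right inner_commute norm_eq_1)
  then have "1 \<le> c\<^sup>2" "c\<^sup>2 \<le> (1 + (norm u)\<^sup>2 / 2)\<^sup>2"
    by (auto simp: power2_sum)
  then have "1 \<le> c" "c \<le> 1 + (norm u)\<^sup>2 / 2"
    using \<open>0 < c\<close> by (auto intro: power2_le_imp_le simp: power2_nonneg_ge_1_iff)
  moreover have "w - (e + u) = (1 - c) *\<^sub>R w" using w(2) by (simp add: algebra_simps)
  ultimately show ?thesis using w(1) by simp
qed

lemma eigenvalue_gap:
  assumes "ordered_eigensystem A l v" and gap: "0 < g" "\<And>j. j \<in> {1..p} \<Longrightarrow> l (j + 1) + g \<le> l j"
  shows "i \<in> {1..p} \<Longrightarrow> i < k \<Longrightarrow> l k + g \<le> l i"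
    and "i \<in> {1..p} \<Longrightarrow> 1 \<le> k \<Longrightarrow> k \<noteq> i \<Longrightarrow> g \<le> \<bar>l i - l k\<bar>"
proof -
  have below: "l k + g \<le> l i" if "i \<in> {1..p}" "i < k" for i k
    using gap(2)[OF that(1)] ordered_eigensystem_antimono[OF assms(1), of "i + 1" k] that by simp
  then show "i \<in> {1..p} \<Longrightarrow> i < k \<Longrightarrow> l k + g \<le> l i" .
  show "g \<le> \<bar>l i - l k\<bar>" if "i \<in> {1..p}" "1 \<le> k" "k \<noteq> i"
    using below[of i k] below[of k i] that by (cases "i < k") auto
qed

text \<open>
  For each \<open>i \<le> p\<close> the fixed point argument gives an eigenvector \<open>v i + u i\<close> of \<open>B\<close> with eigenvalue
  \<open>\<mu> i\<close> near \<open>l i\<close>.  It remains to identify the pair with the \<open>i\<close>-th entry of the list \<open>m\<close>, \<open>w\<close>.  As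
  \<open>\<mu> i\<close> is nonzero, it occurs in the list.  It does not occur after position \<open>i\<close>, where the
  eigenvalues are at most \<open>l (i + 1) + d < \<mu> i\<close>; by induction the positions \<open>k\<close> before \<open>i\<close> are taken by
  the different values \<open>\<mu> k\<close>.  So it occurs at \<open>i\<close> only; its eigenspace is spanned by \<open>w i\<close>, and
  \<open>w i\<close> is the normalization of \<open>v i + u i\<close>.
\<close>

lemma eigensystem_expansion:
  fixes v w :: "nat \<Rightarrow> 'h::{real_inner, banach}"
  assumes A: "ordered_eigensystem A l v" "bounded_linear A" "orthonormal_basis (v ` {1..})"
    and gap: "0 < g" "\<And>j. j \<in> {1..p} \<Longrightarrow> l (j + 1) + g \<le> l j" "\<And>k. 1 \<le> k \<Longrightarrow> 0 \<le> l k"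
    and B: "ordered_eigensystem B m w" "bounded_linear B"
    and close: "\<And>x. norm (B x - A x) \<le> d * norm x" "0 \<le> d" "8 * d \<le> g"
    and sign: "\<And>j. j \<in> {1..p} \<Longrightarrow> inner (w j) (v j) \<noteq> 0 \<Longrightarrow> 0 < inner (w j) (v j)"
    and j: "j \<in> {1..p}"
  shows "norm (w j - v j - reduced_resolvent v {1..} l j (B (v j) - A (v j))) \<le> 20 * (d / g)\<^sup>2"
    and "\<bar>m j - l j - inner (B (v j) - A (v j)) (v j)\<bar> \<le> 4 * d * (d / g)"
proof -
  interpret indexed_basis v "{1..}"
    using A by unfold_locales (auto simp: ordered_eigensystem_def)
  let ?R = "reduced_resolvent v {1..} l"
  let ?D = "\<lambda>x. B x - A x"
  have eigen: "A (v k) = l k *\<^sub>R v k" if "k \<in> {1..}" for k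
    using A(1) that by (auto simp: ordered_eigensystem_def)
  have norm_w: "norm (w k) = 1" if "1 \<le> k" for k
    using B(1) that by (auto simp: ordered_eigensystem_def norm_eq_1)
  have gap_below: "l k + g \<le> l i" if "i \<in> {1..p}" "i < k" for i k
    by (rule eigenvalue_gap(1)[where p = p, OF A(1) gap(1)]) (use gap(2) that in auto)
  have gap_abs: "g \<le> \<bar>l i - l k\<bar>" if "i \<in> {1..p}" "k \<in> {1..}" "k \<noteq> i" for i k
    by (rule eigenvalue_gap(2)[where p = p, OF A(1) gap(1)]) (use gap(2) that in auto)
  define P where "P i u \<mu> \<longleftrightarrow> inner u (v i) = 0 \<and> B (v i + u) = \<mu> *\<^sub>R (v i + u) \<and>
      norm u \<le> 4 * (d / g) \<and> norm (u - ?R i (?D (v i))) \<le> 12 * (d / g)\<^sup>2 \<and>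
      \<bar>\<mu> - l i\<bar> \<le> 2 * d \<and> \<bar>\<mu> - l i - inner (?D (v i)) (v i)\<bar> \<le> 4 * d * (d / g)" for i u \<mu>
  have "\<exists>u \<mu>. P i u \<mu>" if i: "i \<in> {1..p}" for i
  proof -
    have i1: "i \<in> {1..}" using i by simp
    obtain u \<mu> where "inner u (v i) = 0" and eq: "A (v i + u) + ?D (v i + u) = \<mu> *\<^sub>R (v i + u)"
      and "norm u \<le> 4 * (d / g)" "norm (u - ?R i (?D (v i))) \<le> 12 * (d / g)\<^sup>2"
        "\<bar>\<mu> - l i\<bar> \<le> 2 * d" "\<bar>\<mu> - l i - inner (?D (v i)) (v i)\<bar> \<le> 4 * d * (d / g)"
      by (rule perturbed_eigenpair[OF indexed_basis_axioms A(2) eigen i1 gap(1) gap_abs[OF i]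
          bounded_linear_sub[OF B(2) A(2)] close])
    moreover have "B (v i + u) = \<mu> *\<^sub>R (v i + u)" using eq by simp
    ultimately show ?thesis unfolding P_def by blast
  qed
  then obtain u \<mu> where P: "\<And>i. i \<in> {1..p} \<Longrightarrow> P i (u i) (\<mu> i)" by metis
  then have u: "\<And>i. i \<in> {1..p} \<Longrightarrow> inner (u i) (v i) = 0"
    and eq: "\<And>i. i \<in> {1..p} \<Longrightarrow> B (v i + u i) = \<mu> i *\<^sub>R (v i + u i)"
    and u_small: "\<And>i. i \<in> {1..p} \<Longrightarrow> norm (u i) \<le> 4 * (d / g)"
    and u_expansion: "\<And>i. i \<in> {1..p} \<Longrightarrow> norm (u i - ?R i (?D (v i))) \<le> 12 * (d / g)\<^sup>2"
    and \<mu>_close: "\<And>i. i \<in> {1..p} \<Longrightarrow> \<bar>\<mu> i - l i\<bar> \<le> 2 * d"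
    and \<mu>_expansion: "\<And>i. i \<in> {1..p} \<Longrightarrow> \<bar>\<mu> i - l i - inner (?D (v i)) (v i)\<bar> \<le> 4 * d * (d / g)"
    unfolding P_def by blast+
  have in_span: "v i + u i \<in> span (w ` {k. 1 \<le> k \<and> m k = \<mu> i})" if i: "i \<in> {1..p}" for i
  proof -
    have "0 < \<mu> i"
      using \<mu>_close[OF i] gap(2)[OF i] gap(3)[of "i + 1"] gap(1) close(3) by simp
    then show ?thesis using B(1) eq[OF i] by (auto simp: ordered_eigensystem_def)
  qed
  have nonzero: "v i + u i \<noteq> 0" if i: "i \<in> {1..p}" for i
  proof
    assume "v i + u i = 0"
    then have "inner (v i + u i) (v i) = 0" by simp
    moreover have "inner (v i) (v i) = 1" using inner_basis[of i i] i by simp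
    ultimately show False using u[OF i] by (simp add: inner_add_left)
  qed
  \<comment> \<open>each \<open>\<mu> i\<close> occurs in the list of eigenvalues of \<open>B\<close> exactly once, at its own place\<close>
  have index: "{k. 1 \<le> k \<and> m k = \<mu> i} = {i}" if "i \<in> {1..p}" for i
    using that
  proof (induction i rule: less_induct)
    case (less i)
    have "k = i" if k: "1 \<le> k" "m k = \<mu> i" for k
    proof (rule ccontr)
      assume "k \<noteq> i"
      then consider "i < k" | "k < i" by linarith
      then show False
      proof cases
        case 1
        then have "m k \<le> m (i + 1)" by (intro ordered_eigensystem_antimono[OF B(1)]) auto
        also have "\<dots> \<le> l (i + 1) + d"
          by (rule eigenvalue_perturbation_le[OF A B(1) bounded_linear.linear[OF B(2)] close(1)]) simp
        also have "\<dots> < \<mu> i"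
          using \<mu>_close[OF less.prems] gap(2)[OF less.prems] gap(1) close by simp
        finally show False using k by simp
      next
        case 2
        then have kp: "k \<in> {1..p}" using k less.prems by simp
        then have "m k = \<mu> k" using less.IH[OF 2] by blast
        then show False
          using k gap_below[OF kp 2] \<mu>_close[OF less.prems] \<mu>_close[OF kp] gap(1) close by simp
      qed
    qed
    then have sub: "{k. 1 \<le> k \<and> m k = \<mu> i} \<subseteq> {i}" by auto
    moreover have "{k. 1 \<le> k \<and> m k = \<mu> i} \<noteq> {}"
      using in_span[OF less.prems] nonzero[OF less.prems] by (metis image_empty singletonD span_empty)
    ultimately show ?case by blast
  qed
  have "m j = \<mu> j" using index[OF j] by blast
  then show "\<bar>m j - l j - inner (?D (v j)) (v j)\<bar> \<le> 4 * d * (d / g)"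
    using \<mu>_expansion[OF j] by simp
  obtain c where c: "v j + u j = c *\<^sub>R w j"
    using in_span[OF j] unfolding index[OF j] by (auto simp: span_singleton)
  have "norm (w j - (v j + u j)) \<le> (norm (u j))\<^sup>2 / 2"
    by (rule normalization_error[OF _ u[OF j] _ c sign[OF j]]) (use j norm_basis norm_w in auto)
  also have "\<dots> \<le> (4 * (d / g))\<^sup>2 / 2"
    using u_small[OF j] by (intro divide_right_mono power_mono) auto
  also have "\<dots> = 8 * (d / g)\<^sup>2" by (simp add: power2_eq_square)
  finally have "norm (w j - (v j + u j)) \<le> 8 * (d / g)\<^sup>2" .
  moreover have "w j - v j - ?R j (?D (v j)) = (w j - (v j + u j)) + (u j - ?R j (?D (v j)))" by simp
  ultimately show "norm (w j - v j - ?R j (?D (v j))) \<le> 20 * (d / g)\<^sup>2"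
    using u_expansion[OF j] norm_triangle_ineq[of "w j - (v j + u j)" "u j - ?R j (?D (v j))"] by simp
qed

section \<open>Convergence in distribution and small perturbations\<close>

text \<open>
  The greatest \<open>n\<close>-Lipschitz minorant of \<open>f\<close>.  Letting \<open>n\<close> grow it increases to \<open>f\<close> if \<open>f\<close> is
  continuous and bounded, which reduces statements on continuous test functions to Lipschitz ones.
\<close>

definition lipschitz_envelope :: "('a::metric_space \<Rightarrow> real) \<Rightarrow> nat \<Rightarrow> 'a \<Rightarrow> real" where
  "lipschitz_envelope f n x = (INF y. f y + n * dist x y)"

context
  fixes f :: "'a::metric_space \<Rightarrow> real" and b :: real
  assumes bound: "\<bar>f x\<bar> \<le> b"
begin

lemma bdd_below_envelope: "bdd_below (range (\<lambda>y. f y + real n * dist x y))"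
proof (rule bdd_belowI2)
  fix y
  have "0 \<le> real n * dist x y" by simp
  then show "- b \<le> f y + real n * dist x y" using bound[of y] by linarith
qed

lemma lipschitz_envelope_le: "lipschitz_envelope f n x \<le> f x"
  unfolding lipschitz_envelope_def
  by (rule cINF_lower2[OF bdd_below_envelope, of x]) auto

lemma le_lipschitz_envelope: "- b \<le> lipschitz_envelope f n x"
  unfolding lipschitz_envelope_def
proof (rule cINF_greatest)
  fix y
  have "0 \<le> real n * dist x y" by simp
  then show "- b \<le> f y + real n * dist x y" using bound[of y] by linarith
qed simp

lemma abs_lipschitz_envelope_le: "\<bar>lipschitz_envelope f n x\<bar> \<le> b"
  using le_lipschitz_envelope[of n x] lipschitz_envelope_le[of n x] bound[of x] by auto

lemma lipschitz_envelope_diff: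
  "\<bar>lipschitz_envelope f n x - lipschitz_envelope f n z\<bar> \<le> n * dist x z"
proof -
  have "lipschitz_envelope f n x - n * dist x z \<le> lipschitz_envelope f n z" for x z
    unfolding lipschitz_envelope_def[of f n z]
  proof (rule cINF_greatest)
    fix y
    have "lipschitz_envelope f n x \<le> f y + n * dist x y"
      unfolding lipschitz_envelope_def by (rule cINF_lower[OF bdd_below_envelope]) simp
    also have "\<dots> \<le> f y + n * (dist x z + dist z y)"
      by (intro add_left_mono mult_left_mono dist_triangle) auto
    finally show "lipschitz_envelope f n x - n * dist x z \<le> f y + n * dist z y"
      by (simp add: algebra_simps)
  qed simp
  from this[of x z] this[of z x] show ?thesis by (simp add: dist_commute)
qed

lemma continuous_lipschitz_envelope: "continuous_on UNIV (lipschitz_envelope f n)"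
proof (rule continuous_onI)
  fix x :: 'a and e :: real assume e: "0 < e"
  show "\<exists>d>0. \<forall>z\<in>UNIV. dist z x < d \<longrightarrow> dist (lipschitz_envelope f n z) (lipschitz_envelope f n x) \<le> e"
  proof (intro exI[of _ "e / (n + 1)"] conjI ballI impI)
    fix z assume "dist z x < e / (n + 1)"
    then have "real n * dist z x \<le> real n * (e / (n + 1))" by (intro mult_left_mono) auto
    also have "\<dots> \<le> e" using e by (simp add: field_simps)
    finally show "dist (lipschitz_envelope f n z) (lipschitz_envelope f n x) \<le> e"
      using lipschitz_envelope_diff[of n z x] by (simp add: dist_real_def)
  qed (use e in auto)
qed

lemma lipschitz_envelope_tendsto:
  assumes "continuous_on UNIV f"
  shows "(\<lambda>n. lipschitz_envelope f n x) \<longlonglongrightarrow> f x"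
proof (rule LIMSEQ_I)
  fix e :: real assume e: "0 < e"
  obtain d where d: "0 < d" and near: "\<And>y. dist y x < d \<Longrightarrow> dist (f y) (f x) < e / 2"
    using assms e unfolding continuous_on_iff by (metis UNIV_I half_gt_zero)
  obtain m :: nat where m: "2 * b / d < m" using reals_Archimedean2 by blast
  have "norm (lipschitz_envelope f n x - f x) < e" if n: "m \<le> n" for n
  proof -
    have "f x - e / 2 \<le> lipschitz_envelope f n x"
      unfolding lipschitz_envelope_def
    proof (rule cINF_greatest)
      fix y
      show "f x - e / 2 \<le> f y + n * dist x y"
      proof (cases "dist y x < d")
        case True
        have "0 \<le> n * dist x y" by simp
        then show ?thesis using near[OF True] unfolding dist_real_def by linarith
      next
        case False
        have "2 * b < m * d" using m d by (simp add: field_simps)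
        also have "\<dots> \<le> n * d" using n d by (intro mult_right_mono) auto
        also have "\<dots> \<le> n * dist x y" using False by (intro mult_left_mono) (auto simp: dist_commute)
        finally show ?thesis using bound[of x] bound[of y] e by (auto simp: abs_le_iff)
      qed
    qed simp
    then show ?thesis using lipschitz_envelope_le[of n x] e by (auto simp: abs_if)
  qed
  then show "\<exists>m. \<forall>n\<ge>m. norm (lipschitz_envelope f n x - f x) < e" by blast
qed

end

lemma (in prob_space) integrable_bounded_continuous:
  fixes f :: "'b::topological_space \<Rightarrow> real"
  assumes "continuous_on UNIV f" "\<And>x. \<bar>f x\<bar> \<le> b" "Y \<in> borel_measurable M"
  shows "integrable M (\<lambda>\<omega>. f (Y \<omega>))"
  using assms
  by (intro integrable_const_bound[where B = b])
     (auto intro!: measurable_compose[OF assms(3)] borel_measurable_continuous_onI)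

text \<open>
  Where the two variables are \<open>\<epsilon>\<close>-close the integrands differ by at most \<open>L \<epsilon>\<close>; the rest of the space
  has small probability, and there the difference is at most \<open>2 b\<close>.
\<close>

lemma (in prob_space) lipschitz_expectation_diff_tendsto_0:
  fixes Y Y' :: "nat \<Rightarrow> 'a \<Rightarrow> 'b::{metric_space, second_countable_topology}"
  assumes meas[measurable]: "\<And>n. Y n \<in> borel_measurable M" "\<And>n. Y' n \<in> borel_measurable M"
    and close: "\<And>\<epsilon>. 0 < \<epsilon> \<Longrightarrow> (\<lambda>n. prob {\<omega>\<in>space M. \<epsilon> < dist (Y n \<omega>) (Y' n \<omega>)}) \<longlonglongrightarrow> 0"
    and g: "continuous_on UNIV g" "\<And>x. \<bar>g x\<bar> \<le> b" "\<And>x y. \<bar>g x - g y\<bar> \<le> L * dist x y" "0 \<le> L"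
  shows "(\<lambda>n. (\<integral>\<omega>. g (Y n \<omega>) \<partial>M) - (\<integral>\<omega>. g (Y' n \<omega>) \<partial>M)) \<longlonglongrightarrow> 0"
proof (rule LIMSEQ_I)
  fix e :: real assume e: "0 < e"
  define \<epsilon> where "\<epsilon> = e / (2 * (L + 1))"
  have \<epsilon>: "0 < \<epsilon>" "L * \<epsilon> < e / 2" using e g(4) by (auto simp: \<epsilon>_def field_simps)
  have b: "0 \<le> b" using g(2)[of undefined] by simp
  let ?A = "\<lambda>n. {\<omega>\<in>space M. \<epsilon> < dist (Y n \<omega>) (Y' n \<omega>)}"
  have [measurable]: "?A n \<in> sets M" for n by measurable
  have int: "integrable M (\<lambda>\<omega>. g (Y n \<omega>))" "integrable M (\<lambda>\<omega>. g (Y' n \<omega>))" for n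
    by (rule integrable_bounded_continuous[OF g(1,2) meas(1)], rule integrable_bounded_continuous[OF g(1,2) meas(2)])
  have diff: "\<bar>(\<integral>\<omega>. g (Y n \<omega>) \<partial>M) - (\<integral>\<omega>. g (Y' n \<omega>) \<partial>M)\<bar> \<le> L * \<epsilon> + 2 * b * prob (?A n)" for n
  proof -
    have "\<bar>(\<integral>\<omega>. g (Y n \<omega>) \<partial>M) - (\<integral>\<omega>. g (Y' n \<omega>) \<partial>M)\<bar> = \<bar>\<integral>\<omega>. g (Y n \<omega>) - g (Y' n \<omega>) \<partial>M\<bar>"
      using int by (simp add: Bochner_Integration.integral_diff)
    also have "\<dots> \<le> (\<integral>\<omega>. \<bar>g (Y n \<omega>) - g (Y' n \<omega>)\<bar> \<partial>M)"
      by (rule integral_abs_bound)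
    also have "\<dots> \<le> (\<integral>\<omega>. L * \<epsilon> + 2 * b * indicator (?A n) \<omega> \<partial>M)"
    proof (rule integral_mono)
      fix \<omega> assume \<omega>: "\<omega> \<in> space M"
      show "\<bar>g (Y n \<omega>) - g (Y' n \<omega>)\<bar> \<le> L * \<epsilon> + 2 * b * indicator (?A n) \<omega>"
      proof (cases "\<epsilon> < dist (Y n \<omega>) (Y' n \<omega>)")
        case True
        have "0 \<le> L * \<epsilon>" using \<epsilon>(1) g(4) by simp
        then show ?thesis using g(2)[of "Y n \<omega>"] g(2)[of "Y' n \<omega>"] True \<omega> by simp
      next
        case False
        then have "L * dist (Y n \<omega>) (Y' n \<omega>) \<le> L * \<epsilon>" using g(4) by (intro mult_left_mono) auto
        then show ?thesis using g(3)[of "Y n \<omega>" "Y' n \<omega>"] False by simp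
      qed
    qed (use int in \<open>auto intro!: integrable_abs Bochner_Integration.integrable_add integrable_mult_right integrable_real_indicator simp: emeasure_eq_measure\<close>)
    also have "\<dots> = L * \<epsilon> + 2 * b * prob (?A n)"
      by (subst Bochner_Integration.integral_add) (auto simp: prob_space emeasure_eq_measure)
    finally show ?thesis .
  qed
  have "(\<lambda>n. L * \<epsilon> + 2 * b * prob (?A n)) \<longlonglongrightarrow> L * \<epsilon> + 2 * b * 0"
    by (intro tendsto_intros close \<epsilon>)
  then have "\<forall>\<^sub>F n in sequentially. L * \<epsilon> + 2 * b * prob (?A n) < e"
    by (rule order_tendstoD(2)) (use \<epsilon>(2) e in simp)
  then obtain n0 where "\<And>n. n \<ge> n0 \<Longrightarrow> L * \<epsilon> + 2 * b * prob (?A n) < e"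
    by (auto simp: eventually_sequentially)
  then show "\<exists>n0. \<forall>n\<ge>n0. norm ((\<integral>\<omega>. g (Y n \<omega>) \<partial>M) - (\<integral>\<omega>. g (Y' n \<omega>) \<partial>M) - 0) < e"
    using diff by (intro exI[of _ n0]) (auto intro: le_less_trans)
qed

text \<open>
  Slutsky's lemma.  For a Lipschitz test function the expectations at \<open>Y n\<close> and \<open>Y' n\<close> have the same
  limit.  A Lipschitz minorant whose expectation at the limit is close to that of \<open>f\<close> then bounds the
  lower limit of the expectations of \<open>f\<close> from below; applied to \<open>-f\<close> this bounds the upper limit
  from above.
\<close>

lemma expectation_tendsto_if_close_in_probability:
  fixes Y Y' :: "nat \<Rightarrow> 'w \<Rightarrow> 'b::{metric_space, second_countable_topology}" and Y\<^sub>0 :: "'u \<Rightarrow> 'b"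
    and f :: "'b \<Rightarrow> real"
  assumes "prob_space M" "prob_space M'"
    and meas[measurable]: "\<And>n. Y n \<in> borel_measurable M" "\<And>n. Y' n \<in> borel_measurable M" "Y\<^sub>0 \<in> borel_measurable M'"
    and close: "\<And>\<epsilon>. 0 < \<epsilon> \<Longrightarrow> (\<lambda>n. measure M {\<omega>\<in>space M. \<epsilon> < dist (Y n \<omega>) (Y' n \<omega>)}) \<longlonglongrightarrow> 0"
    and conv: "\<And>g :: 'b \<Rightarrow> real. continuous_on UNIV g \<Longrightarrow> bounded (range g) \<Longrightarrow>
        (\<lambda>n. \<integral>\<omega>. g (Y' n \<omega>) \<partial>M) \<longlonglongrightarrow> (\<integral>\<omega>. g (Y\<^sub>0 \<omega>) \<partial>M')"
    and f: "continuous_on UNIV f" "bounded (range f)"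
  shows "(\<lambda>n. \<integral>\<omega>. f (Y n \<omega>) \<partial>M) \<longlonglongrightarrow> (\<integral>\<omega>. f (Y\<^sub>0 \<omega>) \<partial>M')"
proof -
  interpret M: prob_space M by fact
  interpret M': prob_space M' by fact
  have lower: "\<forall>\<^sub>F n in sequentially. a < (\<integral>\<omega>. f (Y n \<omega>) \<partial>M)"
    if f: "continuous_on UNIV f" and fb: "\<And>x. \<bar>f x\<bar> \<le> b" and a: "a < (\<integral>\<omega>. f (Y\<^sub>0 \<omega>) \<partial>M')"
    for f :: "'b \<Rightarrow> real" and b a
  proof -
    let ?g = "lipschitz_envelope f"
    note cont = continuous_lipschitz_envelope[of f b, OF fb]
    note bounds = abs_lipschitz_envelope_le[of f b, OF fb]
    have [measurable]: "f \<in> borel_measurable borel" "?g k \<in> borel_measurable borel" for k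
      using f cont by (auto intro: borel_measurable_continuous_onI)
    have "(\<lambda>k. \<integral>\<omega>. ?g k (Y\<^sub>0 \<omega>) \<partial>M') \<longlonglongrightarrow> (\<integral>\<omega>. f (Y\<^sub>0 \<omega>) \<partial>M')"
      by (rule integral_dominated_convergence[where w = "\<lambda>_. b"])
         (use bounds lipschitz_envelope_tendsto[of f b, OF fb f] in \<open>auto simp: \<close>)
    then obtain k where k: "a < (\<integral>\<omega>. ?g k (Y\<^sub>0 \<omega>) \<partial>M')"
      using order_tendstoD(1)[OF _ a] by (metis (mono_tags, lifting) eventually_happens' sequentially_bot)
    have "bounded (range (?g k))"
      using bounds by (auto simp: bounded_iff)
    from conv[OF cont this]
    have "(\<lambda>n. ((\<integral>\<omega>. ?g k (Y n \<omega>) \<partial>M) - (\<integral>\<omega>. ?g k (Y' n \<omega>) \<partial>M)) + (\<integral>\<omega>. ?g k (Y' n \<omega>) \<partial>M))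
        \<longlonglongrightarrow> 0 + (\<integral>\<omega>. ?g k (Y\<^sub>0 \<omega>) \<partial>M')"
      by (intro tendsto_add M.lipschitz_expectation_diff_tendsto_0[OF meas(1,2) close cont bounds
            lipschitz_envelope_diff[of f b, OF fb]]) auto
    then have "\<forall>\<^sub>F n in sequentially. a < (\<integral>\<omega>. ?g k (Y n \<omega>) \<partial>M)"
      using k by (intro order_tendstoD(1)) simp_all
    then show ?thesis
    proof (rule eventually_mono)
      fix n assume "a < (\<integral>\<omega>. ?g k (Y n \<omega>) \<partial>M)"
      also have "\<dots> \<le> (\<integral>\<omega>. f (Y n \<omega>) \<partial>M)"
        by (intro integral_mono M.integrable_bounded_continuous[OF cont bounds]
              M.integrable_bounded_continuous[OF f fb] lipschitz_envelope_le[of f b, OF fb] meas)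
      finally show "a < (\<integral>\<omega>. f (Y n \<omega>) \<partial>M)" .
    qed
  qed
  obtain b where b: "\<And>x. \<bar>f x\<bar> \<le> b" using f(2) by (auto simp: bounded_iff)
  show ?thesis
  proof (rule order_tendstoI)
    fix a assume "a < (\<integral>\<omega>. f (Y\<^sub>0 \<omega>) \<partial>M')"
    with f(1) b show "\<forall>\<^sub>F n in sequentially. a < (\<integral>\<omega>. f (Y n \<omega>) \<partial>M)" by (rule lower)
  next
    fix a assume "(\<integral>\<omega>. f (Y\<^sub>0 \<omega>) \<partial>M') < a"
    then have "\<forall>\<^sub>F n in sequentially. - a < (\<integral>\<omega>. - f (Y n \<omega>) \<partial>M)"
      using b by (intro lower[of "\<lambda>x. - f x" b "- a"] continuous_on_minus f) auto
    then show "\<forall>\<^sub>F n in sequentially. (\<integral>\<omega>. f (Y n \<omega>) \<partial>M) < a" by simp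
  qed
qed

lemma random_element_euclidean: "random_element M euclidean Y \<longleftrightarrow> Y \<in> borel_measurable M"
  by (simp add: random_element_def borel_def)

text \<open>
  Norms of a sequence that converges in distribution are bounded in probability: the continuous
  function \<open>h k\<close> is \<open>1\<close> where the norm is at least \<open>k + 1\<close> and \<open>0\<close> where it is at most \<open>k\<close>, so its
  expectation dominates the tail probability, and at the limit it is small for large \<open>k\<close>.
\<close>

lemma tight_if_converges_in_distribution:
  fixes Z :: "nat \<Rightarrow> 'w \<Rightarrow> 'b::real_normed_vector"
  assumes "prob_space M" "prob_space M'"
    and conv: "converges_in_distribution euclidean M Z M' Z\<^sub>0" and \<eta>: "0 < \<eta>"
  shows "\<exists>R. \<forall>\<^sub>F n in sequentially. measure M {\<omega>\<in>space M. R < norm (Z n \<omega>)} < \<eta>"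
proof -
  interpret M: prob_space M by fact
  interpret M': prob_space M' by fact
  have [measurable]: "Z n \<in> borel_measurable M" "Z\<^sub>0 \<in> borel_measurable M'" for n
    using conv by (auto simp: converges_in_distribution_def random_element_euclidean)
  define h where "h k z = min 1 (max 0 (norm z - real k))" for k and z :: 'b
  have h_cont: "continuous_on UNIV (h k)" for k
    unfolding h_def by (intro continuous_intros)
  have h_bound: "\<bar>h k z\<bar> \<le> 1" for k z by (simp add: h_def)
  have [measurable]: "h k \<in> borel_measurable borel" for k
    using h_cont by (rule borel_measurable_continuous_onI)
  have "(\<lambda>k. h k z) \<longlonglongrightarrow> 0" for z
  proof (rule tendsto_eventually)
    obtain m :: nat where "norm z \<le> m" using real_arch_simple by blast
    then show "\<forall>\<^sub>F k in sequentially. h k z = 0"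
      by (intro eventually_sequentiallyI[of m]) (auto simp: h_def)
  qed
  then have "(\<lambda>k. \<integral>\<omega>. h k (Z\<^sub>0 \<omega>) \<partial>M') \<longlonglongrightarrow> (\<integral>\<omega>. 0 \<partial>M')"
    by (intro integral_dominated_convergence[where w = "\<lambda>_. 1"]) (use h_bound in auto)
  then have "(\<lambda>k. \<integral>\<omega>. h k (Z\<^sub>0 \<omega>) \<partial>M') \<longlonglongrightarrow> 0" by simp
  then have "\<forall>\<^sub>F k in sequentially. (\<integral>\<omega>. h k (Z\<^sub>0 \<omega>) \<partial>M') < \<eta>"
    by (rule order_tendstoD(2)) (rule \<eta>)
  then obtain k where k: "(\<integral>\<omega>. h k (Z\<^sub>0 \<omega>) \<partial>M') < \<eta>"
    by (auto simp: eventually_sequentially)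
  have "bounded (range (h k))" using h_bound by (auto simp: bounded_iff)
  then have "(\<lambda>n. \<integral>\<omega>. h k (Z n \<omega>) \<partial>M) \<longlonglongrightarrow> (\<integral>\<omega>. h k (Z\<^sub>0 \<omega>) \<partial>M')"
    using conv h_cont by (auto simp: converges_in_distribution_def)
  then have "\<forall>\<^sub>F n in sequentially. (\<integral>\<omega>. h k (Z n \<omega>) \<partial>M) < \<eta>"
    using k by (rule order_tendstoD(2))
  then have "\<forall>\<^sub>F n in sequentially. measure M {\<omega>\<in>space M. real k + 1 < norm (Z n \<omega>)} < \<eta>"
  proof (rule eventually_mono)
    fix n assume n: "(\<integral>\<omega>. h k (Z n \<omega>) \<partial>M) < \<eta>"
    let ?A = "{\<omega>\<in>space M. real k + 1 < norm (Z n \<omega>)}"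
    have [measurable]: "?A \<in> sets M" by measurable
    have "measure M ?A = (\<integral>\<omega>. indicator ?A \<omega> \<partial>M)" by simp
    also have "\<dots> \<le> (\<integral>\<omega>. h k (Z n \<omega>) \<partial>M)"
    proof (rule integral_mono)
      show "integrable M (indicator ?A :: 'w \<Rightarrow> real)" by (simp add: M.emeasure_eq_measure)
      show "integrable M (\<lambda>\<omega>. h k (Z n \<omega>))"
        by (rule M.integrable_bounded_continuous[OF h_cont h_bound]) measurable
      show "indicator ?A \<omega> \<le> h k (Z n \<omega>)" for \<omega> by (auto simp: h_def indicator_def)
    qed
    finally show "measure M ?A < \<eta>" using n by simp
  qed
  then show ?thesis by blast
qed

text \<open>
  A remainder of second order vanishes in probability: outside an event of small probability
  \<open>\<parallel>Z n\<parallel>\<close> is at most some constant \<open>R\<close>, and then the remainder is at most \<open>\<bar>K\<bar> R\<^sup>2 / r n\<close> for large \<open>n\<close>.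
\<close>

lemma remainder_tendsto_0_in_probability:
  fixes Z :: "nat \<Rightarrow> 'w \<Rightarrow> 'b::real_normed_vector"
    and Y Y' :: "nat \<Rightarrow> 'w \<Rightarrow> 'c::{metric_space, second_countable_topology}"
  assumes "prob_space M" "prob_space M'"
    and conv: "converges_in_distribution euclidean M Z M' Z\<^sub>0"
    and r: "filterlim r at_top sequentially" and c: "0 < c"
    and meas[measurable]: "\<And>n. Y n \<in> borel_measurable M" "\<And>n. Y' n \<in> borel_measurable M"
    and bound: "\<And>n. AE \<omega> in M. 0 < r n \<longrightarrow> norm (Z n \<omega>) \<le> c * r n \<longrightarrow>
        dist (Y n \<omega>) (Y' n \<omega>) \<le> K * (norm (Z n \<omega>))\<^sup>2 / r n"
    and \<epsilon>: "0 < \<epsilon>"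
  shows "(\<lambda>n. measure M {\<omega>\<in>space M. \<epsilon> < dist (Y n \<omega>) (Y' n \<omega>)}) \<longlonglongrightarrow> 0"
proof (rule LIMSEQ_I)
  interpret M: prob_space M by fact
  have [measurable]: "Z n \<in> borel_measurable M" for n
    using conv by (auto simp: converges_in_distribution_def random_element_euclidean)
  fix \<eta> :: real assume "0 < \<eta>"
  from tight_if_converges_in_distribution[OF assms(1-3) this]
  obtain R where tight: "\<forall>\<^sub>F n in sequentially. measure M {\<omega>\<in>space M. R < norm (Z n \<omega>)} < \<eta>" by blast
  have "\<forall>\<^sub>F n in sequentially. max (\<bar>R\<bar> / c) (\<bar>K\<bar> * R\<^sup>2 / \<epsilon>) + 1 \<le> r n"
    using r by (simp add: filterlim_at_top)
  with tight have "\<forall>\<^sub>F n in sequentially. measure M {\<omega>\<in>space M. \<epsilon> < dist (Y n \<omega>) (Y' n \<omega>)} < \<eta>"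
  proof eventually_elim
    case (elim n)
    have "\<bar>R\<bar> / c \<le> r n" "\<bar>K\<bar> * R\<^sup>2 / \<epsilon> \<le> r n" "0 < r n"
      using elim(2) c divide_nonneg_pos[of "\<bar>R\<bar>" c]
        max.cobounded1[of "\<bar>R\<bar> / c" "\<bar>K\<bar> * R\<^sup>2 / \<epsilon>"] max.cobounded2[of "\<bar>K\<bar> * R\<^sup>2 / \<epsilon>" "\<bar>R\<bar> / c"]
      by linarith+
    then have n: "\<bar>R\<bar> \<le> c * r n" "\<bar>K\<bar> * R\<^sup>2 / r n \<le> \<epsilon>" "0 < r n"
      using c \<epsilon> by (auto simp: field_simps)
    have "AE \<omega> in M. \<omega> \<in> {\<omega>\<in>space M. \<epsilon> < dist (Y n \<omega>) (Y' n \<omega>)} \<longrightarrow> \<omega> \<in> {\<omega>\<in>space M. R < norm (Z n \<omega>)}"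
      using bound[of n]
    proof (rule AE_mp, intro AE_I2 impI)
      fix \<omega> assume b: "0 < r n \<longrightarrow> norm (Z n \<omega>) \<le> c * r n \<longrightarrow> dist (Y n \<omega>) (Y' n \<omega>) \<le> K * (norm (Z n \<omega>))\<^sup>2 / r n"
        and \<omega>: "\<omega> \<in> {\<omega>\<in>space M. \<epsilon> < dist (Y n \<omega>) (Y' n \<omega>)}"
      have "R < norm (Z n \<omega>)"
      proof (rule ccontr)
        assume "\<not> R < norm (Z n \<omega>)"
        then have z: "norm (Z n \<omega>) \<le> \<bar>R\<bar>" by simp
        with b n have "dist (Y n \<omega>) (Y' n \<omega>) \<le> K * (norm (Z n \<omega>))\<^sup>2 / r n" by auto
        also have "\<dots> \<le> \<bar>K\<bar> * \<bar>R\<bar>\<^sup>2 / r n"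
          using z n(3) by (intro divide_right_mono mult_mono power_mono) auto
        finally show False using n(2) \<omega> by simp
      qed
      with \<omega> show "\<omega> \<in> {\<omega>\<in>space M. R < norm (Z n \<omega>)}" by simp
    qed
    then have "measure M {\<omega>\<in>space M. \<epsilon> < dist (Y n \<omega>) (Y' n \<omega>)} \<le> measure M {\<omega>\<in>space M. R < norm (Z n \<omega>)}"
      by (rule M.finite_measure_mono_AE) measurable
    with elim(1) show ?case by simp
  qed
  then show "\<exists>n0. \<forall>n\<ge>n0. norm (measure M {\<omega>\<in>space M. \<epsilon> < dist (Y n \<omega>) (Y' n \<omega>)} - 0) < \<eta>"
    by (auto simp: eventually_sequentially)
qed

text \<open>
  Restriction to \<open>{1..p}\<close> transports statements from the type \<open>nat \<Rightarrow> 'a\<close>, which is a metric space with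
  the product topology, to the power space.
\<close>

lemma continuous_map_restrict_power_space:
  "continuous_map euclidean (power_space p) (\<lambda>x :: nat \<Rightarrow> 'a::topological_space. restrict x {1..p})"
  unfolding continuous_map_componentwise euclidean_product_topology[symmetric]
  by (auto intro!: continuous_map_product_projection)

lemma restrict_measurable:
  fixes Y :: "nat \<Rightarrow> 'w \<Rightarrow> 'a::second_countable_topology"
  assumes "\<And>j. j \<in> {1..p} \<Longrightarrow> Y j \<in> borel_measurable M"
  shows "(\<lambda>\<omega>. \<lambda>j\<in>{1..p}. Y j \<omega>) \<in> borel_measurable M"
proof (rule measurable_coordinatewise_then_product)
  fix j show "(\<lambda>\<omega>. (\<lambda>j\<in>{1..p}. Y j \<omega>) j) \<in> borel_measurable M"
    using assms by (cases "j \<in> {1..p}") (auto simp: restrict_def)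
qed

text \<open>
  Open sets are pulled back to the type \<open>nat \<Rightarrow> 'a\<close>, where second countability makes a function with
  measurable coordinates Borel measurable.
\<close>

lemma random_element_power_space:
  fixes Y :: "nat \<Rightarrow> 'w \<Rightarrow> 'a::second_countable_topology"
  assumes "\<And>j. j \<in> {1..p} \<Longrightarrow> Y j \<in> borel_measurable M"
  shows "random_element M (power_space p) (\<lambda>\<omega>. \<lambda>j\<in>{1..p}. Y j \<omega>)"
  unfolding random_element_def
proof (rule measurable_measure_of)
  show "{U. openin (power_space p) U} \<subseteq> Pow (topspace (power_space p))"
    using openin_subset by blast
  show "(\<lambda>\<omega>. \<lambda>j\<in>{1..p}. Y j \<omega>) \<in> space M \<rightarrow> topspace (power_space p :: (nat \<Rightarrow> 'a) topology)" by auto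
  fix U :: "(nat \<Rightarrow> 'a) set" assume "U \<in> {U. openin (power_space p) U}"
  then have "openin euclidean ((\<lambda>x. restrict x {1..p}) -` U)"
    using openin_continuous_map_preimage[OF continuous_map_restrict_power_space, of p U]
    by (simp add: vimage_def)
  then have U: "(\<lambda>x. restrict x {1..p}) -` U \<in> sets borel" by simp
  have "(\<lambda>\<omega>. \<lambda>j\<in>{1..p}. Y j \<omega>) \<in> borel_measurable M"
    by (rule restrict_measurable[OF assms])
  from measurable_sets[OF this U]
  show "(\<lambda>\<omega>. \<lambda>j\<in>{1..p}. Y j \<omega>) -` U \<inter> space M \<in> sets M"
    by (simp add: vimage_def)
qed

text \<open>
  The weights \<open>(1/2)^n\<close> in the product metric sum to \<open>2\<close>.
\<close>

lemma dist_fun_le_twice_sup: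
  fixes x y :: "nat \<Rightarrow> 'a::metric_space"
  assumes "\<And>j. dist (x j) (y j) \<le> e"
  shows "dist x y \<le> 2 * e"
proof -
  have e: "0 \<le> e" using assms[of 0] zero_le_dist order_trans by blast
  have "dist x y \<le> (\<Sum>n. (1/2) ^ n * e)"
    unfolding dist_fun_def
  proof (rule suminf_le)
    show "(1/2) ^ n * min (dist (x (from_nat n)) (y (from_nat n))) 1 \<le> (1/2) ^ n * e" for n
      using assms[of "from_nat n"] by (intro mult_left_mono) auto
    show "summable (\<lambda>n. (1/2 :: real) ^ n * e)"
      by (intro summable_mult2 summable_geometric) simp
    show "summable (\<lambda>n. (1/2) ^ n * min (dist (x (from_nat n)) (y (from_nat n))) 1)"
      by (rule summable_comparison_test'[of "\<lambda>n. (1/2)^n"]) (auto simp: summable_geometric_iff)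
  qed
  also have "\<dots> = 2 * e"
    using suminf_mult2[of "\<lambda>n. (1/2 :: real) ^ n" e] suminf_geometric[of "1/2 :: real"]
    by (simp add: summable_geometric_iff)
  finally show ?thesis .
qed

text \<open>
  By Slutsky's lemma it is enough that the vectors of the \<open>\<Phi> j (Z n)\<close> converge, which they do as
  continuous images of \<open>Z n\<close>.  Closeness in probability of finitely many coordinates is closeness in
  probability of the vectors.
\<close>

lemma converges_in_distribution_power_space:
  fixes Z :: "nat \<Rightarrow> 'w \<Rightarrow> 'b::real_normed_vector"
    and Y :: "nat \<Rightarrow> nat \<Rightarrow> 'w \<Rightarrow> 'a::{metric_space, second_countable_topology}"
  assumes P: "prob_space M" "prob_space M'"
    and conv: "converges_in_distribution euclidean M Z M' Z\<^sub>0"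
    and meas: "\<And>n j. j \<in> {1..p} \<Longrightarrow> Y n j \<in> borel_measurable M"
    and \<Phi>: "\<And>j. j \<in> {1..p} \<Longrightarrow> continuous_on UNIV (\<Phi> j)"
    and close: "\<And>j \<epsilon>. j \<in> {1..p} \<Longrightarrow> 0 < \<epsilon> \<Longrightarrow>
        (\<lambda>n. measure M {\<omega>\<in>space M. \<epsilon> < dist (Y n j \<omega>) (\<Phi> j (Z n \<omega>))}) \<longlonglongrightarrow> 0"
  shows "converges_in_distribution (power_space p)
      M (\<lambda>n \<omega>. \<lambda>j\<in>{1..p}. Y n j \<omega>) M' (\<lambda>\<omega>. \<lambda>j\<in>{1..p}. \<Phi> j (Z\<^sub>0 \<omega>))"
proof -
  interpret M: prob_space M by (rule P)
  have Z[measurable]: "Z n \<in> borel_measurable M" "Z\<^sub>0 \<in> borel_measurable M'" for n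
    using conv by (auto simp: converges_in_distribution_def random_element_euclidean)
  have \<Phi>_meas: "\<Phi> j \<in> borel_measurable borel" if "j \<in> {1..p}" for j
    using \<Phi>[OF that] by (rule borel_measurable_continuous_onI)
  have \<Phi>Z: "(\<lambda>\<omega>. \<Phi> j (Z n \<omega>)) \<in> borel_measurable M" "(\<lambda>\<omega>. \<Phi> j (Z\<^sub>0 \<omega>)) \<in> borel_measurable M'"
    if "j \<in> {1..p}" for j n
    using measurable_compose[OF Z(1) \<Phi>_meas[OF that]] measurable_compose[OF Z(2) \<Phi>_meas[OF that]] by auto
  let ?Y = "\<lambda>n \<omega>. \<lambda>j\<in>{1..p}. Y n j \<omega>"
  let ?\<Phi> = "\<lambda>z. \<lambda>j\<in>{1..p}. \<Phi> j z"
  have cont_\<Phi>: "continuous_on UNIV ?\<Phi>"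
  proof (rule continuous_on_coordinatewise_then_product)
    fix j show "continuous_on UNIV (\<lambda>z. ?\<Phi> z j)"
      using \<Phi> by (cases "j \<in> {1..p}") (auto simp: restrict_def)
  qed
  have close': "(\<lambda>n. measure M {\<omega>\<in>space M. \<epsilon> < dist (?Y n \<omega>) (?\<Phi> (Z n \<omega>))}) \<longlonglongrightarrow> 0" if \<epsilon>: "0 < \<epsilon>" for \<epsilon>
  proof (rule tendsto_sandwich[OF _ _ tendsto_const])
    let ?A = "\<lambda>n j. {\<omega>\<in>space M. \<epsilon> / 2 < dist (Y n j \<omega>) (\<Phi> j (Z n \<omega>))}"
    have A: "?A n j \<in> sets M" if "j \<in> {1..p}" for n j
    proof -
      note [measurable] = meas[OF that] \<Phi>Z[OF that]
      show ?thesis by measurable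
    qed
    have "(\<lambda>n. \<Sum>j\<in>{1..p}. measure M (?A n j)) \<longlonglongrightarrow> (\<Sum>j\<in>{1..p}. 0)"
      using \<epsilon> by (intro tendsto_sum close) auto
    then show "(\<lambda>n. \<Sum>j\<in>{1..p}. measure M (?A n j)) \<longlonglongrightarrow> 0" by simp
    show "\<forall>\<^sub>F n in sequentially. measure M {\<omega>\<in>space M. \<epsilon> < dist (?Y n \<omega>) (?\<Phi> (Z n \<omega>))}
        \<le> (\<Sum>j\<in>{1..p}. measure M (?A n j))"
    proof (rule always_eventually, rule allI)
      fix n
      have "measure M {\<omega>\<in>space M. \<epsilon> < dist (?Y n \<omega>) (?\<Phi> (Z n \<omega>))} \<le> measure M (\<Union>j\<in>{1..p}. ?A n j)"
      proof (rule M.finite_measure_mono)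
        show "(\<Union>j\<in>{1..p}. ?A n j) \<in> sets M" using A by auto
        show "{\<omega>\<in>space M. \<epsilon> < dist (?Y n \<omega>) (?\<Phi> (Z n \<omega>))} \<subseteq> (\<Union>j\<in>{1..p}. ?A n j)"
        proof (intro subsetI, rule ccontr)
          fix \<omega> assume \<omega>: "\<omega> \<in> {\<omega>\<in>space M. \<epsilon> < dist (?Y n \<omega>) (?\<Phi> (Z n \<omega>))}"
            and "\<omega> \<notin> (\<Union>j\<in>{1..p}. ?A n j)"
          then have *: "dist (Y n j \<omega>) (\<Phi> j (Z n \<omega>)) \<le> \<epsilon> / 2" if "j \<in> {1..p}" for j
            using that by force
          have "dist (?Y n \<omega>) (?\<Phi> (Z n \<omega>)) \<le> 2 * (\<epsilon> / 2)"
          proof (rule dist_fun_le_twice_sup)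
            fix j show "dist (?Y n \<omega> j) (?\<Phi> (Z n \<omega>) j) \<le> \<epsilon> / 2"
              using * \<epsilon> by (cases "j \<in> {1..p}") (auto simp: restrict_def)
          qed
          then show False using \<omega> by simp
        qed
      qed
      also have "\<dots> \<le> (\<Sum>j\<in>{1..p}. measure M (?A n j))"
        by (rule measure_UNION_le) (use A in auto)
      finally show "measure M {\<omega>\<in>space M. \<epsilon> < dist (?Y n \<omega>) (?\<Phi> (Z n \<omega>))} \<le> (\<Sum>j\<in>{1..p}. measure M (?A n j))" .
    qed
  qed simp
  show ?thesis
    unfolding converges_in_distribution_def
  proof (intro conjI allI impI)
    show "random_element M (power_space p) (?Y n)" for n
      by (rule random_element_power_space[OF meas])
    show "random_element M' (power_space p) (\<lambda>\<omega>. ?\<Phi> (Z\<^sub>0 \<omega>))"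
      by (rule random_element_power_space[OF \<Phi>Z(2)])
    fix f :: "(nat \<Rightarrow> 'a) \<Rightarrow> real"
    assume f: "continuous_map (power_space p) euclideanreal f \<and> bounded (f ` topspace (power_space p))"
    let ?F = "\<lambda>x. f (restrict x {1..p})"
    have "continuous_map euclidean euclideanreal (f \<circ> (\<lambda>x. restrict x {1..p}))"
      using f continuous_map_restrict_power_space by (intro continuous_map_compose) auto
    then have F: "continuous_on UNIV ?F" by (simp add: o_def)
    have Fb: "bounded (range ?F)"
      using f by (elim conjE bounded_subset) auto
    have "(\<lambda>n. \<integral>\<omega>. ?F (?Y n \<omega>) \<partial>M) \<longlonglongrightarrow> (\<integral>\<omega>. ?F (?\<Phi> (Z\<^sub>0 \<omega>)) \<partial>M')"
    proof (rule expectation_tendsto_if_close_in_probability[OF P _ _ _ close' _ F Fb])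
      show "?Y n \<in> borel_measurable M" for n by (rule restrict_measurable[OF meas])
      show "(\<lambda>\<omega>. ?\<Phi> (Z n \<omega>)) \<in> borel_measurable M" for n by (rule restrict_measurable[OF \<Phi>Z(1)])
      show "(\<lambda>\<omega>. ?\<Phi> (Z\<^sub>0 \<omega>)) \<in> borel_measurable M'" by (rule restrict_measurable[OF \<Phi>Z(2)])
      fix g :: "(nat \<Rightarrow> 'a) \<Rightarrow> real" assume g: "continuous_on UNIV g" "bounded (range g)"
      have "continuous_on UNIV (\<lambda>z. g (?\<Phi> z))"
        by (rule continuous_on_compose2[OF g(1) cont_\<Phi>]) auto
      moreover have "bounded (range (\<lambda>z. g (?\<Phi> z)))"
        using g(2) by (rule bounded_subset) auto
      ultimately show "(\<lambda>n. \<integral>\<omega>. g (?\<Phi> (Z n \<omega>)) \<partial>M) \<longlonglongrightarrow> (\<integral>\<omega>. g (?\<Phi> (Z\<^sub>0 \<omega>)) \<partial>M')"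
        using conv by (auto simp: converges_in_distribution_def)
    qed
    then show "(\<lambda>n. \<integral>\<omega>. f (?Y n \<omega>) \<partial>M) \<longlonglongrightarrow> (\<integral>\<omega>. f (?\<Phi> (Z\<^sub>0 \<omega>)) \<partial>M')" by simp
  qed
qed

text \<open>
  The delta method for finitely many quantities at once: what is, up to a second order remainder, a
  continuous function of \<open>Z n\<close> converges to that function of the limit.
\<close>

lemma converges_in_distribution_first_order:
  fixes Z :: "nat \<Rightarrow> 'w \<Rightarrow> 'b::real_normed_vector"
    and Y :: "nat \<Rightarrow> nat \<Rightarrow> 'w \<Rightarrow> 'a::{metric_space, second_countable_topology}"
  assumes P: "prob_space M" "prob_space M'"
    and conv: "converges_in_distribution euclidean M Z M' Z\<^sub>0"
    and r: "filterlim r at_top sequentially" and c: "0 < c"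
    and meas: "\<And>n j. j \<in> {1..p} \<Longrightarrow> Y n j \<in> borel_measurable M"
    and \<Phi>: "\<And>j. j \<in> {1..p} \<Longrightarrow> continuous_on UNIV (\<Phi> j)"
    and bound: "\<And>n j. j \<in> {1..p} \<Longrightarrow> AE \<omega> in M. 0 < r n \<longrightarrow> norm (Z n \<omega>) \<le> c * r n \<longrightarrow>
        dist (Y n j \<omega>) (\<Phi> j (Z n \<omega>)) \<le> K * (norm (Z n \<omega>))\<^sup>2 / r n"
  shows "converges_in_distribution (power_space p)
      M (\<lambda>n \<omega>. \<lambda>j\<in>{1..p}. Y n j \<omega>) M' (\<lambda>\<omega>. \<lambda>j\<in>{1..p}. \<Phi> j (Z\<^sub>0 \<omega>))"
proof (rule converges_in_distribution_power_space[OF P conv meas \<Phi>])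
  fix j \<epsilon> assume j: "j \<in> {1..p}" and \<epsilon>: "0 < (\<epsilon> :: real)"
  have Z: "Z n \<in> borel_measurable M" for n
    using conv by (simp add: converges_in_distribution_def random_element_euclidean)
  have "(\<lambda>\<omega>. \<Phi> j (Z n \<omega>)) \<in> borel_measurable M" for n
    by (rule measurable_compose[OF Z borel_measurable_continuous_onI[OF \<Phi>[OF j]]])
  then show "(\<lambda>n. measure M {\<omega>\<in>space M. \<epsilon> < dist (Y n j \<omega>) (\<Phi> j (Z n \<omega>))}) \<longlonglongrightarrow> 0"
    by (rule remainder_tendsto_0_in_probability[OF P conv r c meas[OF j] _ bound[OF j] \<epsilon>])
qed

section \<open>Limit distributions of eigenvalues and eigenfunctions\<close>

text \<open>
  The squares of the eigenvalues of a Hilbert--Schmidt operator are summable, so a decreasing list of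
  them cannot become negative.
\<close>

lemma eigenvalue_nonneg:
  assumes eigen: "ordered_eigensystem (hs_apply C) l v" and basis: "orthonormal_basis (v ` {1..})"
    and m: "1 \<le> m"
  shows "0 \<le> l m"
proof (rule ccontr)
  interpret indexed_basis v "{1..}"
    using eigen basis by unfold_locales (auto simp: ordered_eigensystem_def)
  assume neg: "\<not> 0 \<le> l m"
  have norm_C: "(norm (hs_apply C (v k)))\<^sup>2 = (l k)\<^sup>2" if "k \<in> {1..}" for k
    using eigen norm_basis[OF that] that by (auto simp: ordered_eigensystem_def)
  have "(\<lambda>k. (norm (hs_apply C (v k)))\<^sup>2) summable_on {1..}"
    using summable_hs_norm[OF basis, of C] unfolding summable_on_reindex[OF inj_basis] by (simp add: o_def)
  then have summable: "(\<lambda>k. (l k)\<^sup>2) summable_on {1..}"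
    by (rule summable_on_cong[THEN iffD1, rotated]) (rule norm_C)
  have "real n * (l m)\<^sup>2 \<le> (\<Sum>\<^sub>\<infinity>k\<in>{1..}. (l k)\<^sup>2)" for n
  proof -
    have "real n * (l m)\<^sup>2 = (\<Sum>k\<in>{m..<m+n}. (l m)\<^sup>2)" by simp
    also have "\<dots> \<le> (\<Sum>k\<in>{m..<m+n}. (l k)\<^sup>2)"
    proof (rule sum_mono)
      fix k assume "k \<in> {m..<m+n}"
      then have "l k \<le> l m" by (intro ordered_eigensystem_antimono[OF eigen m]) simp
      then show "(l m)\<^sup>2 \<le> (l k)\<^sup>2" using neg by (simp add: abs_le_square_iff[symmetric])
    qed
    also have "\<dots> \<le> (\<Sum>\<^sub>\<infinity>k\<in>{1..}. (l k)\<^sup>2)"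
      by (rule finite_sum_le_infsum[OF summable]) (use m in auto)
    finally show ?thesis .
  qed
  moreover have "0 < (l m)\<^sup>2" using neg by simp
  ultimately show False by (meson ex_less_of_nat_mult not_le)
qed

lemma uniform_gap_exists:
  fixes l :: "nat \<Rightarrow> real"
  assumes "\<And>j. j \<in> {1..p} \<Longrightarrow> l (j + 1) < l j"
  obtains g where "0 < g" "\<And>j. j \<in> {1..p} \<Longrightarrow> l (j + 1) + g \<le> l j"
proof -
  let ?G = "insert 1 ((\<lambda>j. l j - l (j + 1)) ` {1..p})"
  have "0 < Min ?G" using assms by (subst Min_gr_iff) auto
  moreover have "l (j + 1) + Min ?G \<le> l j" if "j \<in> {1..p}" for j
  proof -
    have "Min ?G \<le> l j - l (j + 1)" using that by (intro Min_le) auto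
    then show ?thesis by simp
  qed
  ultimately show thesis by (rule that)
qed

text \<open>
  The limit \<open>T j\<close> of the theorem is a continuous linear function of \<open>Z\<close>.
\<close>

lemma reduced_resolvent_hs_apply:
  fixes A :: "'h::{real_inner, second_countable_topology} hs"
  shows "reduced_resolvent v I l j (hs_apply A (v j)) =
    (\<Sum>\<^sub>\<infinity>k\<in>I - {j}. (inverse (l j - l k) * inner A (v j \<otimes> v k)) *\<^sub>R v k)"
  unfolding reduced_resolvent_def diagonal_op_def
  by (rule infsum_cong_neutral) (auto simp: inner_tensor)

theorem theorem4p1:
  fixes \<T> :: "'e::euclidean_space set"
    and J :: "'h::{banach, real_inner, second_countable_topology} \<Rightarrow> 'e \<Rightarrow> real"
    and M :: "'w measure" and M' :: "'u measure"
    and X :: "'w \<Rightarrow> 'h"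
    and C :: "'h hs" and C_hat :: "nat \<Rightarrow> 'w \<Rightarrow> 'h hs" and Z :: "'u \<Rightarrow> 'h hs"
    and r :: "nat \<Rightarrow> real"
    and lam :: "nat \<Rightarrow> real" and v :: "nat \<Rightarrow> 'h"
    and lam_hat :: "nat \<Rightarrow> nat \<Rightarrow> 'w \<Rightarrow> real" and v_hat :: "nat \<Rightarrow> nat \<Rightarrow> 'w \<Rightarrow> 'h"
    and T :: "nat \<Rightarrow> 'u \<Rightarrow> 'h" and p :: nat
  assumes "compact \<T>" and "is_L2 \<T> J"
    and "prob_space M" and "prob_space M'"
    and "X \<in> borel_measurable M" and "integrable M (\<lambda>\<omega>. (norm (X \<omega>))\<^sup>2)"
    and "\<And>x. hs_apply C x = covariance_operator M X x"
    and "\<And>N. C_hat N \<in> borel_measurable M"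
    and "\<And>N. AE \<omega> in M. symmetric_op (hs_apply (C_hat N \<omega>)) \<and> nonneg_definite (hs_apply (C_hat N \<omega>))"
    and "filterlim r at_top sequentially"
    and "converges_in_distribution euclidean M (\<lambda>N \<omega>. r N *\<^sub>R (C_hat N \<omega> - C)) M' Z"
    and "ordered_eigensystem (hs_apply C) lam v"
    and "orthonormal_basis (v ` {1..})"
    and "\<And>j. j \<in> {1..p} \<Longrightarrow> lam j > lam (j + 1)"
    and "\<And>N j. j \<ge> 1 \<Longrightarrow> lam_hat N j \<in> borel_measurable M"
    and "\<And>N j. j \<ge> 1 \<Longrightarrow> v_hat N j \<in> borel_measurable M"
    and "\<And>N. AE \<omega> in M.
           ordered_eigensystem (hs_apply (C_hat N \<omega>)) (\<lambda>j. lam_hat N j \<omega>) (\<lambda>j. v_hat N j \<omega>)"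
    and "\<And>N j. j \<ge> 1 \<Longrightarrow>
           AE \<omega> in M. inner (v_hat N j \<omega>) (v j) \<noteq> 0 \<longrightarrow> sgn (inner (v_hat N j \<omega>) (v j)) = 1"
    and "\<And>j \<omega>. j \<in> {1..p} \<Longrightarrow>
           T j \<omega> = (\<Sum>\<^sub>\<infinity>k\<in>{1..} - {j}. (inverse (lam j - lam k) * inner (Z \<omega>) (v j \<otimes> v k)) *\<^sub>R v k)"
  shows "converges_in_distribution (power_space p)
           M (\<lambda>N \<omega>. \<lambda>j\<in>{1..p}. r N *\<^sub>R (v_hat N j \<omega> - v j))
           M' (\<lambda>\<omega>. \<lambda>j\<in>{1..p}. T j \<omega>)
       \<and> converges_in_distribution (power_space p)
           M (\<lambda>N \<omega>. \<lambda>j\<in>{1..p}. r N * (lam_hat N j \<omega> - lam j))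
           M' (\<lambda>\<omega>. \<lambda>j\<in>{1..p}. inner (hs_apply (Z \<omega>) (v j)) (v j))"
proof -
  let ?Z = "\<lambda>N \<omega>. r N *\<^sub>R (C_hat N \<omega> - C)"
  let ?R = "reduced_resolvent v {1..} lam"
  let ?d = "\<lambda>N \<omega>. norm (C_hat N \<omega> - C)"
  note prob = \<open>prob_space M\<close> \<open>prob_space M'\<close>
    and conv = \<open>converges_in_distribution euclidean M ?Z M' Z\<close>
    and eigen = \<open>ordered_eigensystem (hs_apply C) lam v\<close>
    and basis = \<open>orthonormal_basis (v ` {1..})\<close>
    and r = \<open>filterlim r at_top sequentially\<close>
  have v_hat_meas: "1 \<le> j \<Longrightarrow> v_hat N j \<in> borel_measurable M"
    and lam_hat_meas: "1 \<le> j \<Longrightarrow> lam_hat N j \<in> borel_measurable M" for N j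
    by (fact assms)+
  obtain g where g: "0 < g" "\<And>j. j \<in> {1..p} \<Longrightarrow> lam (j + 1) + g \<le> lam j"
    using uniform_gap_exists[of p lam] assms(14) by blast
  \<comment> \<open>the deterministic expansion at a sample point, with \<open>d = \<parallel>C_hat - C\<parallel>\<close>\<close>
  have expansion: "AE \<omega> in M. ?d N \<omega> \<le> g / 8 \<longrightarrow>
      norm (v_hat N j \<omega> - v j - ?R j (hs_apply (C_hat N \<omega> - C) (v j))) \<le> 20 * (?d N \<omega> / g)\<^sup>2 \<and>
      \<bar>lam_hat N j \<omega> - lam j - inner (hs_apply (C_hat N \<omega> - C) (v j)) (v j)\<bar> \<le> 4 * ?d N \<omega> * (?d N \<omega> / g)"
    if j: "j \<in> {1..p}" for N j
  proof -
    have "AE \<omega> in M. i \<in> {1..p} \<longrightarrow> inner (v_hat N i \<omega>) (v i) \<noteq> 0 \<longrightarrow> sgn (inner (v_hat N i \<omega>) (v i)) = 1" for i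
      using assms(18)[of i N] by (cases "i \<in> {1..p}") auto
    then have "AE \<omega> in M. \<forall>i. i \<in> {1..p} \<longrightarrow> inner (v_hat N i \<omega>) (v i) \<noteq> 0 \<longrightarrow> sgn (inner (v_hat N i \<omega>) (v i)) = 1"
      by (simp add: AE_all_countable)
    then show ?thesis
      using assms(17)[of N]
    proof eventually_elim
      case (elim \<omega>)
      show ?case
      proof (intro impI)
        assume "?d N \<omega> \<le> g / 8"
        then have d: "8 * ?d N \<omega> \<le> g" by simp
        have close: "norm (hs_apply (C_hat N \<omega>) x - hs_apply C x) \<le> ?d N \<omega> * norm x" for x
          using norm_hs_apply_le[of "C_hat N \<omega> - C" x] by (simp add: hs_apply_diff)
        have sign: "0 < inner (v_hat N i \<omega>) (v i)" if "i \<in> {1..p}" "inner (v_hat N i \<omega>) (v i) \<noteq> 0" for i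
          using elim(1) that by (simp add: sgn_1_pos)
        show "norm (v_hat N j \<omega> - v j - ?R j (hs_apply (C_hat N \<omega> - C) (v j))) \<le> 20 * (?d N \<omega> / g)\<^sup>2 \<and>
            \<bar>lam_hat N j \<omega> - lam j - inner (hs_apply (C_hat N \<omega> - C) (v j)) (v j)\<bar> \<le> 4 * ?d N \<omega> * (?d N \<omega> / g)"
          using eigensystem_expansion[OF eigen bounded_linear_hs_apply basis g eigenvalue_nonneg[OF eigen basis]
              elim(2) bounded_linear_hs_apply close norm_ge_zero d sign j]
          by (simp add: hs_apply_diff)
      qed
    qed
  qed
  have "indexed_basis v {1..}"
    using eigen basis by unfold_locales (auto simp: ordered_eigensystem_def)
  then have "bounded_linear (?R j)" if "j \<in> {1..p}" for j
    using that eigenvalue_gap(2)[where p = p, OF eigen g] by (intro bounded_linear_reduced_resolvent[OF _ g(1)]) auto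
  then have R_bl: "bounded_linear (\<lambda>A. ?R j (hs_apply A (v j)))" if "j \<in> {1..p}" for j
    using that by (intro bounded_linear_compose[OF _ bounded_linear_hs_apply_left]) auto
  have inner_bl: "bounded_linear (\<lambda>A. inner (hs_apply A (v j)) (v j))" for j
    by (intro bounded_linear_inner_left_comp bounded_linear_hs_apply_left)
  have T: "T j \<omega> = ?R j (hs_apply (Z \<omega>) (v j))" if "j \<in> {1..p}" for j \<omega>
    using assms(19)[OF that] by (simp add: reduced_resolvent_hs_apply)
  \<comment> \<open>Multiplied by \<open>r N\<close>, the condition \<open>d \<le> g / 8\<close> becomes \<open>\<parallel>Z_N\<parallel> \<le> (g / 8) r N\<close>, and a bound \<open>K d\<^sup>2\<close> on the
    remainder becomes \<open>K \<parallel>Z_N\<parallel>\<^sup>2 / r N\<close>.\<close>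
  have "converges_in_distribution (power_space p)
      M (\<lambda>N \<omega>. \<lambda>j\<in>{1..p}. r N *\<^sub>R (v_hat N j \<omega> - v j))
      M' (\<lambda>\<omega>. \<lambda>j\<in>{1..p}. ?R j (hs_apply (Z \<omega>) (v j)))"
  proof (rule converges_in_distribution_first_order[OF prob conv r, of "g / 8" _ _ _ "20 / g\<^sup>2"])
    fix j assume j: "j \<in> {1..p}"
    show "continuous_on UNIV (\<lambda>A. ?R j (hs_apply A (v j)))"
      by (rule linear_continuous_on[OF R_bl[OF j]])
    show "(\<lambda>\<omega>. r N *\<^sub>R (v_hat N j \<omega> - v j)) \<in> borel_measurable M" for N
      using v_hat_meas[where j = j and N = N] j by simp
    show "AE \<omega> in M. 0 < r N \<longrightarrow> norm (?Z N \<omega>) \<le> g / 8 * r N \<longrightarrow>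
        dist (r N *\<^sub>R (v_hat N j \<omega> - v j)) (?R j (hs_apply (?Z N \<omega>) (v j))) \<le> 20 / g\<^sup>2 * (norm (?Z N \<omega>))\<^sup>2 / r N" for N
      using expansion[OF j, of N]
    proof eventually_elim
      case (elim \<omega>)
      show ?case
      proof (intro impI)
        assume rN: "0 < r N" and "norm (?Z N \<omega>) \<le> g / 8 * r N"
        then have "?d N \<omega> \<le> g / 8" by (simp add: mult.commute)
        with elim have "norm (v_hat N j \<omega> - v j - ?R j (hs_apply (C_hat N \<omega> - C) (v j))) \<le> 20 * (?d N \<omega> / g)\<^sup>2" by blast
        then have "r N * norm (v_hat N j \<omega> - v j - ?R j (hs_apply (C_hat N \<omega> - C) (v j))) \<le> r N * (20 * (?d N \<omega> / g)\<^sup>2)"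
          using rN by (intro mult_left_mono) auto
        moreover have "r N *\<^sub>R (v_hat N j \<omega> - v j) - ?R j (hs_apply (?Z N \<omega>) (v j)) =
            r N *\<^sub>R (v_hat N j \<omega> - v j - ?R j (hs_apply (C_hat N \<omega> - C) (v j)))"
          by (subst linear_cmul[OF bounded_linear.linear[OF R_bl[OF j]]]) (simp add: scaleR_diff_right)
        moreover have "r N * (20 * (?d N \<omega> / g)\<^sup>2) = 20 / g\<^sup>2 * (norm (?Z N \<omega>))\<^sup>2 / r N"
          using rN by (simp add: power2_eq_square)
        ultimately show "dist (r N *\<^sub>R (v_hat N j \<omega> - v j)) (?R j (hs_apply (?Z N \<omega>) (v j))) \<le> 20 / g\<^sup>2 * (norm (?Z N \<omega>))\<^sup>2 / r N"
          using rN by (simp add: dist_norm del: norm_scaleR) simp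
      qed
    qed
  qed (use g in simp)
  moreover have "(\<lambda>\<omega>. \<lambda>j\<in>{1..p}. T j \<omega>) = (\<lambda>\<omega>. \<lambda>j\<in>{1..p}. ?R j (hs_apply (Z \<omega>) (v j)))"
    using T by (intro ext) (simp add: restrict_def)
  moreover have "converges_in_distribution (power_space p)
      M (\<lambda>N \<omega>. \<lambda>j\<in>{1..p}. r N * (lam_hat N j \<omega> - lam j))
      M' (\<lambda>\<omega>. \<lambda>j\<in>{1..p}. inner (hs_apply (Z \<omega>) (v j)) (v j))"
  proof (rule converges_in_distribution_first_order[OF prob conv r, of "g / 8" _ _ _ "4 / g"])
    fix j assume j: "j \<in> {1..p}"
    show "continuous_on UNIV (\<lambda>A. inner (hs_apply A (v j)) (v j))"
      by (rule linear_continuous_on[OF inner_bl])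
    show "(\<lambda>\<omega>. r N * (lam_hat N j \<omega> - lam j)) \<in> borel_measurable M" for N
      using lam_hat_meas[where j = j and N = N] j by simp
    show "AE \<omega> in M. 0 < r N \<longrightarrow> norm (?Z N \<omega>) \<le> g / 8 * r N \<longrightarrow>
        dist (r N * (lam_hat N j \<omega> - lam j)) (inner (hs_apply (?Z N \<omega>) (v j)) (v j)) \<le> 4 / g * (norm (?Z N \<omega>))\<^sup>2 / r N" for N
      using expansion[OF j, of N]
    proof eventually_elim
      case (elim \<omega>)
      show ?case
      proof (intro impI)
        let ?e = "lam_hat N j \<omega> - lam j - inner (hs_apply (C_hat N \<omega> - C) (v j)) (v j)"
        assume rN: "0 < r N" and "norm (?Z N \<omega>) \<le> g / 8 * r N"
        then have "?d N \<omega> \<le> g / 8" by (simp add: mult.commute)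
        with elim have "\<bar>?e\<bar> \<le> 4 * ?d N \<omega> * (?d N \<omega> / g)" by blast
        then have "r N * \<bar>?e\<bar> \<le> r N * (4 * ?d N \<omega> * (?d N \<omega> / g))"
          using rN by (intro mult_left_mono) auto
        moreover have "r N * (lam_hat N j \<omega> - lam j) - inner (hs_apply (?Z N \<omega>) (v j)) (v j) = r N * ?e"
          by (simp add: hs_apply_scaleR right_diff_distrib)
        moreover have "r N * (4 * ?d N \<omega> * (?d N \<omega> / g)) = 4 / g * (norm (?Z N \<omega>))\<^sup>2 / r N"
          using rN by (simp add: power2_eq_square)
        ultimately show "dist (r N * (lam_hat N j \<omega> - lam j)) (inner (hs_apply (?Z N \<omega>) (v j)) (v j)) \<le> 4 / g * (norm (?Z N \<omega>))\<^sup>2 / r N"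
          using rN by (simp add: dist_real_def abs_mult)
      qed
    qed
  qed (use g in simp)
  ultimately show ?thesis by simp
qed

end
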